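(* Let $D$ be a connected ZX-diagram with $\mathcal I(D)=[a_1,\dots,a_n]$, $\mathcal O(D)=[b_1,\dots,b_m]$ and $\mathcal E(D)\neq\emptyset$, let $e\in\mathcal E(D)$, and for $x\in\{0,1\}$ let $t_x$ be a terminal token state (no $\leadsto$ step applies to it) with $(e\downarrow x)(e\uparrow x)\leadsto^* t_x$. If $$\llbracket D\rrbracket=\sum_{q=1}^{2^{m+n}}\lambda_q|y_{1,q}\dots y_{m,q}\rangle\langle x_{1,q}\dots x_{n,q}|$$ (sum over all pairs of computational basis vectors), then $$t_0+t_1=\sum_{q=1}^{2^{m+n}}\lambda_q\prod_{i=1}^m(b_i\downarrow y_{i,q})\prod_{i=1}^n(a_i\uparrow x_{i,q}).$$
   Context: ZX-diagrams. A (pure) ZX-diagram is built from generators by sequential composition $D_2\circ D_1$ (the output edges of $D_1$ are joined to the equally many input edges of $D_2$, the latter relabeled by the former) and parallel composition $D_1\otimes D_2$. Generators: identity (a wire), swap, cup (two input edges $e_0,e_1$, no output), cap (no input, two output edges $e_0,e_1$), green spider $Z^n_m(\alpha)$ ($\alpha\in\mathbb R$, input edges $e_1,\dots,e_n$, output edges $e'_1,\dots,e'_m$), Hadamard gate $H$ (input $e_0$, output $e_1$). Read top to bottom; distinct edges have distinct labels; identity and swap introduce no node. $\mathcal E(D)$ is the set of edges, $\mathcal I(D)$, $\mathcal O(D)$ the lists of dangling input (top) and output (bottom) edges. Each edge has a top and bottom end, top-to-bottom being $\downarrow$, the reverse $\uparrow$. $D$ is connected if it cannot be written as $\sigma'\circ(D_1\otimes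 D_2)\circ\sigma$ with $D_1,D_2$ non-empty diagrams and $\sigma,\sigma'$ permutations of wires. Standard interpretation $\llbracket D\rrbracket:\mathbb C^{2^n}\to\mathbb C^{2^m}$: $\llbracket D_2\circ D_1\rrbracket=\llbracket D_2\rrbracket\circ\llbracket D_1\rrbracket$, $\llbracket D_1\otimes D_2\rrbracket=\llbracket D_1\rrbracket\otimes\llbracket D_2\rrbracket$; identity $\mapsto|0\rangle\langle0|+|1\rangle\langle1|$; swap $\mapsto\sum_{i,j}|ji\rangle\langle ij|$; cap $\mapsto|00\rangle+|11\rangle$; cup $\mapsto\langle00|+\langle11|$; $H\mapsto|+\rangle\langle0|+|-\rangle\langle1|$ with $|\pm\rangle=(|0\rangle\pm|1\rangle)/\sqrt2$; $Z^n_m(\alpha)\mapsto|0^m\rangle\langle0^n|+e^{i\alpha}|1^m\rangle\langle1^n|$. Tokens. A token is $(e\,d\,x)\in\mathcal E(D)\times\{\downarrow,\uparrow\}\times\{0,1\}$; token states are elements of the commutative polynomial algebra $\mathbf{tkS}(D)=\mathbb C[\mathbf{tk}(D)]$ in the tokens. Rules ($x,y,b\in\{0,1\}$, $\neg x=1-x$): Collision $(e\downarrow x)(e\uparrow y)\leadsto_c\delta_{x,y}$. Diffusion: cup $(e_b\downarrow x)\leadsto_d(e_{\neg b}\uparrow x)$; cap $(e_b\uparrow x)\leadsto_d(e_{\neg b}\downarrow x)$; green spider $(e_k\downarrow x)\leadsto_d e^{i\alpha x}\prod_{i\ne k}(e_i\uparrow x)\prod_j(e'_j\downarrow x)$, $(e'_k\uparrow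 x)\leadsto_d e^{i\alpha x}\prod_{j\ne k}(e'_j\downarrow x)\prod_i(e_i\uparrow x)$; Hadamard $(e_0\downarrow x)\leadsto_d\frac{(-1)^x}{\sqrt2}(e_1\downarrow x)+\frac1{\sqrt2}(e_1\downarrow\neg x)$, $(e_1\uparrow x)\leadsto_d\frac{(-1)^x}{\sqrt2}(e_0\uparrow x)+\frac1{\sqrt2}(e_0\uparrow\neg x)$. A step $\leadsto_d$ (resp. $\leadsto_c$) chooses a term and a token (resp. colliding pair) occurring as a factor, replaces it by the right-hand side and expands. Collision-free: no $\leadsto_c$ step applies. $s\leadsto u$ iff $s\leadsto_d s'\leadsto_c^*u$ with $u$ collision-free; $\leadsto^*$ its reflexive-transitive closure. *)

theory Defs
  imports Complex_Main "HOL-Library.Multiset" "HOL-Library.Poly_Mapping"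
begin

text \<open>Diagram terms built from the generators by sequential and parallel composition.
  Comp D2 D1 stands for D2 \<circ> D1 (first D1, then D2); Par D1 D2 for D1 \<otimes> D2.
  Empty is the empty diagram (no wires, no node), needed e.g. as the permutation of
  zero wires.\<close>

datatype zx =
    Empty
  | Id
  | Swap
  | Cup
  | Cap
  | Z nat nat real        \<comment> \<open>Z n m \<alpha>: green spider with n inputs, m outputs, phase \<alpha>\<close>
  | H
  | Comp zx zx
  | Par zx zx

fun nin :: "zx \<Rightarrow> nat" and nout :: "zx \<Rightarrow> nat" where
  "nin Empty = 0" | "nout Empty = 0"
| "nin Id = 1" | "nout Id = 1"
| "nin Swap = 2" | "nout Swap = 2"
| "nin Cup = 2" | "nout Cup = 0"
| "nin Cap = 0" | "nout Cap = 2"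
| "nin (Z n m a) = n" | "nout (Z n m a) = m"
| "nin H = 1" | "nout H = 1"
| "nin (Comp D2 D1) = nin D1" | "nout (Comp D2 D1) = nout D2"
| "nin (Par D1 D2) = nin D1 + nin D2" | "nout (Par D1 D2) = nout D1 + nout D2"

fun wf :: "zx \<Rightarrow> bool" where
  "wf (Comp D2 D1) = (wf D1 \<and> wf D2 \<and> nout D1 = nin D2)"
| "wf (Par D1 D2) = (wf D1 \<and> wf D2)"
| "wf _ = True"

inductive perm_diag :: "zx \<Rightarrow> bool" where
  "perm_diag Empty"
| "perm_diag Id"
| "perm_diag Swap"
| "perm_diag D1 \<Longrightarrow> perm_diag D2 \<Longrightarrow> perm_diag (Par D1 D2)"
| "perm_diag D1 \<Longrightarrow> perm_diag D2 \<Longrightarrow> nout D1 = nin D2 \<Longrightarrow> perm_diag (Comp D2 D1)"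

text \<open>Edges are labelled by natural numbers. A node records its generator and its
  lists of input and output edges.\<close>

datatype node =
    NCup nat nat                 \<comment> \<open>input edges e0, e1\<close>
  | NCap nat nat                 \<comment> \<open>output edges e0, e1\<close>
  | NZ "nat list" "nat list" real  \<comment> \<open>input edges e1..en, output edges e1'..em', phase\<close>
  | NH nat nat                   \<comment> \<open>input edge e0, output edge e1\<close>

fun node_edges :: "node \<Rightarrow> nat set" where
  "node_edges (NCup a b) = {a, b}"
| "node_edges (NCap a b) = {a, b}"
| "node_edges (NZ is os a) = set is \<union> set os"
| "node_edges (NH a b) = {a, b}"

fun map_node :: "(nat \<Rightarrow> nat) \<Rightarrow> node \<Rightarrow> node" where
  "map_node f (NCup a b) = NCup (f a) (f b)"
| "map_node f (NCap a b) = NCap (f a) (f b)"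
| "map_node f (NZ is os a) = NZ (map f is) (map f os) a"
| "map_node f (NH a b) = NH (f a) (f b)"

text \<open>build D ins k: labels the diagram D whose input edges are ins, using fresh labels
  k, k+1, ...; returns the output edges, the nodes and the next fresh label.
  In D2 \<circ> D1 the input edges of D2 are relabelled by the output edges of D1;
  identity and swap introduce no node.\<close>
fun build :: "zx \<Rightarrow> nat list \<Rightarrow> nat \<Rightarrow> nat list \<times> node list \<times> nat" where
  "build Empty ins k = ([], [], k)"
| "build Id ins k = (ins, [], k)"
| "build Swap ins k = ([ins ! 1, ins ! 0], [], k)"
| "build Cup ins k = ([], [NCup (ins ! 0) (ins ! 1)], k)"
| "build Cap ins k = ([k, Suc k], [NCap k (Suc k)], k + 2)"
| "build (Z n m a) ins k = ([k..<k + m], [NZ ins [k..<k + m] a], k + m)"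
| "build H ins k = ([k], [NH (ins ! 0) k], Suc k)"
| "build (Comp D2 D1) ins k =
     (let (o1, n1, k1) = build D1 ins k; (o2, n2, k2) = build D2 o1 k1
      in (o2, n1 @ n2, k2))"
| "build (Par D1 D2) ins k =
     (let (o1, n1, k1) = build D1 (take (nin D1) ins) k;
          (o2, n2, k2) = build D2 (drop (nin D1) ins) k1
      in (o1 @ o2, n1 @ n2, k2))"

text \<open>A labelled diagram graph: (input edges \<I>(D), output edges \<O>(D), multiset of nodes).\<close>
type_synonym graph = "nat list \<times> nat list \<times> node multiset"

definition graph_of :: "zx \<Rightarrow> graph" where
  "graph_of D = (let ins = [0..<nin D]; (os, ns, k) = build D ins (nin D)
                 in (ins, os, mset ns))"

definition inputs :: "zx \<Rightarrow> nat list" where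
  "inputs D = fst (graph_of D)"

definition outputs :: "zx \<Rightarrow> nat list" where
  "outputs D = fst (snd (graph_of D))"

definition nodes :: "zx \<Rightarrow> node multiset" where
  "nodes D = snd (snd (graph_of D))"

definition edges :: "zx \<Rightarrow> nat set" where
  "edges D = set (inputs D) \<union> set (outputs D) \<union> (\<Union>N\<in>set_mset (nodes D). node_edges N)"

definition rename_graph :: "(nat \<Rightarrow> nat) \<Rightarrow> graph \<Rightarrow> graph" where
  "rename_graph f G = (map f (fst G), map f (fst (snd G)), image_mset (map_node f) (snd (snd G)))"

definition nonempty_diag :: "zx \<Rightarrow> bool" where
  "nonempty_diag D \<longleftrightarrow> edges D \<noteq> {} \<or> nodes D \<noteq> {#}"

definition connected_diag :: "zx \<Rightarrow> bool" where
  "connected_diag D \<longleftrightarrow>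
     \<not> (\<exists>D1 D2 \<sigma> \<sigma>' f. perm_diag \<sigma> \<and> perm_diag \<sigma>' \<and>
           wf (Comp \<sigma>' (Comp (Par D1 D2) \<sigma>)) \<and>
           nonempty_diag D1 \<and> nonempty_diag D2 \<and> inj_on f (edges D) \<and>
           graph_of (Comp \<sigma>' (Comp (Par D1 D2) \<sigma>)) = rename_graph f (graph_of D))"

text \<open>interp D ys xs is the matrix entry \<langle>ys| \<lbrakk>D\<rbrakk> |xs\<rangle>, for bit strings ys of length nout D
  and xs of length nin D (bits as booleans, True = 1).\<close>

fun interp :: "zx \<Rightarrow> bool list \<Rightarrow> bool list \<Rightarrow> complex" where
  "interp Empty ys xs = 1"
| "interp Id ys xs = of_bool (ys = xs)"
| "interp Swap ys xs = of_bool (ys = [xs ! 1, xs ! 0])"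
| "interp Cup ys xs = of_bool (xs ! 0 = xs ! 1)"
| "interp Cap ys xs = of_bool (ys ! 0 = ys ! 1)"
| "interp (Z n m a) ys xs =
     of_bool (\<forall>b\<in>set (ys @ xs). \<not> b) + of_bool (\<forall>b\<in>set (ys @ xs). b) * exp (\<i> * of_real a)"
| "interp H ys xs = (if ys ! 0 \<and> xs ! 0 then -1 else 1) / of_real (sqrt 2)"
| "interp (Comp D2 D1) ys xs =
     (\<Sum>zs\<in>{zs. length zs = nout D1}. interp D2 ys zs * interp D1 zs xs)"
| "interp (Par D1 D2) ys xs =
     interp D1 (take (nout D1) ys) (take (nin D1) xs) * interp D2 (drop (nout D1) ys) (drop (nin D1) xs)"

datatype dir = Down | Up

text \<open>A token (e, d, x): edge, direction, bit (True = 1).\<close>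
type_synonym token = "nat \<times> dir \<times> bool"

text \<open>Token states: the commutative polynomial algebra \<complex>[tk(D)], i.e. finitely supported
  maps from monomials (finite multisets of tokens) to complex coefficients.\<close>
type_synonym tkS = "token multiset \<Rightarrow>\<^sub>0 complex"

definition tok :: "token \<Rightarrow> tkS" where
  "tok t = Poly_Mapping.single {#t#} 1"

definition monom :: "token multiset \<Rightarrow> tkS" where
  "monom M = Poly_Mapping.single M 1"

definition phase :: "real \<Rightarrow> bool \<Rightarrow> complex" where
  "phase a x = (if x then exp (\<i> * of_real a) else 1)"

fun node_rule :: "node \<Rightarrow> token \<Rightarrow> tkS \<Rightarrow> bool" where
  "node_rule (NCup e0 e1) (e, d, x) p \<longleftrightarrow>
     d = Down \<and> ((e = e0 \<and> p = tok (e1, Up, x)) \<or> (e = e1 \<and> p = tok (e0, Up, x)))"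
| "node_rule (NCap e0 e1) (e, d, x) p \<longleftrightarrow>
     d = Up \<and> ((e = e0 \<and> p = tok (e1, Down, x)) \<or> (e = e1 \<and> p = tok (e0, Down, x)))"
| "node_rule (NZ is os a) (e, d, x) p \<longleftrightarrow>
     (d = Down \<and> e \<in> set is \<and>
        p = Poly_Mapping.single
              (image_mset (\<lambda>e'. (e', Up, x)) (mset (remove1 e is)) +
               image_mset (\<lambda>e'. (e', Down, x)) (mset os)) (phase a x)) \<or>
     (d = Up \<and> e \<in> set os \<and>
        p = Poly_Mapping.single
              (image_mset (\<lambda>e'. (e', Down, x)) (mset (remove1 e os)) +
               image_mset (\<lambda>e'. (e', Up, x)) (mset is)) (phase a x))"
| "node_rule (NH e0 e1) (e, d, x) p \<longleftrightarrow>
     (d = Down \<and> e = e0 \<and>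
        p = Poly_Mapping.single {#(e1, Down, x)#} ((if x then -1 else 1) / of_real (sqrt 2))
          + Poly_Mapping.single {#(e1, Down, \<not> x)#} (1 / of_real (sqrt 2))) \<or>
     (d = Up \<and> e = e1 \<and>
        p = Poly_Mapping.single {#(e0, Up, x)#} ((if x then -1 else 1) / of_real (sqrt 2))
          + Poly_Mapping.single {#(e0, Up, \<not> x)#} (1 / of_real (sqrt 2)))"

definition diff_rule :: "zx \<Rightarrow> token \<Rightarrow> tkS \<Rightarrow> bool" where
  "diff_rule D t p \<longleftrightarrow> (\<exists>N\<in>#nodes D. node_rule N t p)"

definition diff_step :: "zx \<Rightarrow> tkS \<Rightarrow> tkS \<Rightarrow> bool" where
  "diff_step D s s' \<longleftrightarrow>
     (\<exists>M t p. Poly_Mapping.lookup s M \<noteq> 0 \<and> t \<in># M \<and> diff_rule D t p \<and>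
        s' = s - Poly_Mapping.single M (Poly_Mapping.lookup s M)
               + Poly_Mapping.single (M - {#t#}) (Poly_Mapping.lookup s M) * p)"

definition coll_step :: "tkS \<Rightarrow> tkS \<Rightarrow> bool" where
  "coll_step s s' \<longleftrightarrow>
     (\<exists>M e x y. Poly_Mapping.lookup s M \<noteq> 0 \<and> (e, Down, x) \<in># M \<and> (e, Up, y) \<in># M \<and>
        s' = s - Poly_Mapping.single M (Poly_Mapping.lookup s M)
               + Poly_Mapping.single (M - {#(e, Down, x), (e, Up, y)#})
                   (Poly_Mapping.lookup s M * of_bool (x = y)))"

definition collision_free :: "tkS \<Rightarrow> bool" where
  "collision_free s \<longleftrightarrow> \<not> (\<exists>s'. coll_step s s')"

definition tk_step :: "zx \<Rightarrow> tkS \<Rightarrow> tkS \<Rightarrow> bool" where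
  "tk_step D s u \<longleftrightarrow> (\<exists>s'. diff_step D s s' \<and> coll_step\<^sup>*\<^sup>* s' u \<and> collision_free u)"

definition terminal :: "zx \<Rightarrow> tkS \<Rightarrow> bool" where
  "terminal D t \<longleftrightarrow> \<not> (\<exists>u. tk_step D t u)"

end

theory Submission
  imports Defs
begin

text \<open>
  Write the matrix entries of a diagram as a state sum: sum over all labellings of the edges by
  bits, with one weight per node. A token state that starts at the edge e0 explores the
  diagram: for every monomial M there is a set R of nodes already traversed, and M carries
  exactly one token, pointing outwards, on each edge leaving R. Contracting the untraversed
  nodes against the bits of M gives an amplitude that diffusion and collision both preserve,
  because diffusion through a node just expands its weight. Connectedness makes R a function of M,
  so the amplitude extends linearly to token states, and it forces R to be everything when no token
  can move, so that a terminal state is its own amplitude. Summing over the two bits on e0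
  turns the initial amplitudes into the full state sum.
\<close>

section \<open>Diagrams as state sums\<close>

text \<open>Like monomials produced along different branches merge or cancel, so a token state keeps
  no history: whatever is tracked must be read off a monomial alone. The one ambiguity that
  connectedness leaves is the empty region. In a closed loop the tokens can come back to
  \<open>e0\<close>, and the start monomial reappears with every node traversed and in general
  another amplitude. Values are therefore attached to nonempty regions only, and the first diffusion
  is treated apart; it is also the only one that starts from a colliding pair. Later steps rely on
  collision-freeness, since otherwise a token could diffuse back into traversed nodes. Everything is
  done for one coefficient at a time, that of a fixed boundary monomial \<open>T\<close>, which
  makes amplitudes complex numbers. Connectedness is given as indecomposability of terms up to
  renaming and has to be turned into a statement about the graph: a term is cut in two along a set
  of edges that no node straddles. The same argument excludes the edgeless spider, a scalar that
  enters the interpretation but that no token can reach.\<close>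

fun node_ins :: "node \<Rightarrow> nat list" where
  "node_ins (NCup a b) = [a, b]"
| "node_ins (NCap a b) = []"
| "node_ins (NZ is os \<alpha>) = is"
| "node_ins (NH a b) = [a]"

fun node_outs :: "node \<Rightarrow> nat list" where
  "node_outs (NCup a b) = []"
| "node_outs (NCap a b) = [a, b]"
| "node_outs (NZ is os \<alpha>) = os"
| "node_outs (NH a b) = [b]"

lemma node_edges_eq: "node_edges N = set (node_ins N) \<union> set (node_outs N)"
  by (cases N) auto

text \<open>A labelling of the edges by bits is encoded as the set \<open>L\<close> of edges that
  carry the bit 1; the weight is then the matrix entry of the generator at the bits of its own
  edges.\<close>

fun weight :: "nat set \<Rightarrow> node \<Rightarrow> complex" where
  "weight L (NCup a b) = of_bool (a \<in> L \<longleftrightarrow> b \<in> L)"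
| "weight L (NCap a b) = of_bool (a \<in> L \<longleftrightarrow> b \<in> L)"
| "weight L (NZ is os \<alpha>) =
     of_bool (\<forall>e\<in>set (os @ is). e \<notin> L) + of_bool (\<forall>e\<in>set (os @ is). e \<in> L) * exp (\<i> * of_real \<alpha>)"
| "weight L (NH a b) = (if b \<in> L \<and> a \<in> L then -1 else 1) / of_real (sqrt 2)"

lemma weight_cong:
  assumes "\<And>e. e \<in> node_edges N \<Longrightarrow> e \<in> L \<longleftrightarrow> e \<in> L'"
  shows "weight L N = weight L' N"
proof (cases N)
  case (NZ es os \<alpha>)
  have "(\<forall>e\<in>set (os @ es). e \<notin> L) = (\<forall>e\<in>set (os @ es). e \<notin> L')"
    "(\<forall>e\<in>set (os @ es). e \<in> L) = (\<forall>e\<in>set (os @ es). e \<in> L')"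
    using assms NZ by auto
  then show ?thesis using NZ by simp
qed (use assms in auto)

abbreviation weights :: "nat set \<Rightarrow> node list \<Rightarrow> complex" where
  "weights L ns \<equiv> prod_list (map (weight L) ns)"

lemma weights_cong:
  assumes "\<And>N e. N \<in> set ns \<Longrightarrow> e \<in> node_edges N \<Longrightarrow> e \<in> L \<longleftrightarrow> e \<in> L'"
  shows "weights L ns = weights L' ns"
  using assms by (intro arg_cong[where f = prod_list] map_cong refl weight_cong) auto

text \<open>The last two conjuncts are the incidence law of wires: once \<open>ins\<close> is
  duplicate-free, every label has exactly one origin (a diagram input or a node output) and exactly
  one destination (a node input or a diagram output). Multisets record this without separate
  distinctness claims. No node feeds itself because outputs are always fresh.\<close>

lemma build_structure:
  assumes "wf D" "length ins = nin D" "set ins \<subseteq> {..<k}" "build D ins k = (os, ns, k')"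
  shows "k \<le> k' \<and> length os = nout D \<and> set os \<subseteq> {..<k'} \<and>
    (\<forall>N\<in>set ns. node_edges N \<subseteq> {..<k'} \<and> set (node_ins N) \<inter> set (node_outs N) = {}) \<and>
    concat (map node_outs ns) = [k..<k'] \<and>
    mset (concat (map node_ins ns)) + mset os = mset ins + mset [k..<k']"
  using assms
proof (induction D arbitrary: ins k os ns k')
  case (Comp D2 D1)
  obtain o1 n1 k1 where b1: "build D1 ins k = (o1, n1, k1)" by (cases "build D1 ins k")
  obtain o2 n2 k2 where b2: "build D2 o1 k1 = (o2, n2, k2)" by (cases "build D2 o1 k1")
  have eq: "os = o2" "ns = n1 @ n2" "k' = k2" using Comp.prems b1 b2 by auto
  note I1 = Comp.IH(2)[OF _ _ _ b1]
  have I1: "k \<le> k1" "length o1 = nout D1" "set o1 \<subseteq> {..<k1}"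
    "\<forall>N\<in>set n1. node_edges N \<subseteq> {..<k1} \<and> set (node_ins N) \<inter> set (node_outs N) = {}"
    "concat (map node_outs n1) = [k..<k1]"
    "mset (concat (map node_ins n1)) + mset o1 = mset ins + mset [k..<k1]"
    using I1 Comp.prems by auto
  have I2: "k1 \<le> k2" "length o2 = nout D2" "set o2 \<subseteq> {..<k2}"
    "\<forall>N\<in>set n2. node_edges N \<subseteq> {..<k2} \<and> set (node_ins N) \<inter> set (node_outs N) = {}"
    "concat (map node_outs n2) = [k1..<k2]"
    "mset (concat (map node_ins n2)) + mset o2 = mset o1 + mset [k1..<k2]"
    using Comp.IH(1)[OF _ _ _ b2] Comp.prems I1 by auto
  have "[k..<k2] = [k..<k1] @ [k1..<k2]"
    using I1(1) I2(1) upt_add_eq_append[of k k1 "k2 - k1"] by simp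
  moreover have "\<forall>N\<in>set n1. node_edges N \<subseteq> {..<k2}"
    using I1(4) I2(1) by fastforce
  moreover have "mset (concat (map node_ins (n1 @ n2))) + mset o2 =
      mset ins + mset ([k..<k1] @ [k1..<k2])"
    using I1(6) I2(6) by (simp add: ac_simps) (metis add.assoc add.commute)
  ultimately show ?case unfolding eq using I1 I2 by auto
next
  case (Par D1 D2)
  let ?i1 = "take (nin D1) ins" and ?i2 = "drop (nin D1) ins"
  obtain o1 n1 k1 where b1: "build D1 ?i1 k = (o1, n1, k1)" by (cases "build D1 ?i1 k")
  obtain o2 n2 k2 where b2: "build D2 ?i2 k1 = (o2, n2, k2)" by (cases "build D2 ?i2 k1")
  have eq: "os = o1 @ o2" "ns = n1 @ n2" "k' = k2" using Par.prems b1 b2 by auto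
  have s1: "set ?i1 \<subseteq> {..<k}" using Par.prems(3) by (meson order_trans set_take_subset)
  have I1: "k \<le> k1" "length o1 = nout D1" "set o1 \<subseteq> {..<k1}"
    "\<forall>N\<in>set n1. node_edges N \<subseteq> {..<k1} \<and> set (node_ins N) \<inter> set (node_outs N) = {}"
    "concat (map node_outs n1) = [k..<k1]"
    "mset (concat (map node_ins n1)) + mset o1 = mset ?i1 + mset [k..<k1]"
    using Par.IH(1)[OF _ _ s1 b1] Par.prems by auto
  have s2: "set ?i2 \<subseteq> {..<k1}" using Par.prems(3) I1(1) by (auto dest!: in_set_dropD)
  have I2: "k1 \<le> k2" "length o2 = nout D2" "set o2 \<subseteq> {..<k2}"
    "\<forall>N\<in>set n2. node_edges N \<subseteq> {..<k2} \<and> set (node_ins N) \<inter> set (node_outs N) = {}"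
    "concat (map node_outs n2) = [k1..<k2]"
    "mset (concat (map node_ins n2)) + mset o2 = mset ?i2 + mset [k1..<k2]"
    using Par.IH(2)[OF _ _ s2 b2] Par.prems by auto
  have "[k..<k2] = [k..<k1] @ [k1..<k2]"
    using I1(1) I2(1) upt_add_eq_append[of k k1 "k2 - k1"] by simp
  moreover have "\<forall>N\<in>set n1. node_edges N \<subseteq> {..<k2}"
    using I1(4) I2(1) by fastforce
  moreover have "mset ins = mset ?i1 + mset ?i2"
    by (metis append_take_drop_id mset_append)
  moreover from this have "mset (concat (map node_ins (n1 @ n2))) + mset (o1 @ o2) =
      mset ins + mset ([k..<k1] @ [k1..<k2])"
    using arg_cong2[where f = "(+)", OF I1(6) I2(6)] by (simp add: ac_simps)
  moreover have "set o1 \<subseteq> {..<k2}" using I1(3) I2(1) by auto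
  ultimately show ?case unfolding eq using I1 I2 by auto
next
  case Swap
  then obtain a b where "ins = [a, b]" by (auto simp: length_Suc_conv numeral_2_eq_2)
  with Swap show ?case by auto
next
  case Cup
  then obtain a b where "ins = [a, b]" by (auto simp: length_Suc_conv numeral_2_eq_2)
  with Cup show ?case by auto
next
  case H
  then obtain a where "ins = [a]" by (auto simp: length_Suc_conv)
  with H show ?case by auto
next
  case Cap
  then show ?case by (auto simp: atLeastLessThanSuc)
qed auto

lemma sum_Pow_Un:
  fixes g :: "'a set \<Rightarrow> 'b::comm_monoid_add"
  assumes "finite A" "finite B" "A \<inter> B = {}"
  shows "(\<Sum>L\<in>Pow (A \<union> B). g L) = (\<Sum>L1\<in>Pow A. \<Sum>L2\<in>Pow B. g (L1 \<union> L2))"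
proof -
  have "(\<Sum>L1\<in>Pow A. \<Sum>L2\<in>Pow B. g (L1 \<union> L2)) = (\<Sum>p\<in>Pow A \<times> Pow B. g (fst p \<union> snd p))"
    by (simp add: sum.cartesian_product case_prod_beta)
  also have "\<dots> = (\<Sum>L\<in>Pow (A \<union> B). g L)"
    by (rule sum.reindex_bij_witness[where i = "\<lambda>L. (L \<inter> A, L \<inter> B)" and j = "\<lambda>p. fst p \<union> snd p"])
      (use assms(3) in auto)
  finally show ?thesis by simp
qed

lemma finite_bool_lists: "finite {zs :: bool list. length zs = n}"
  using finite_lists_length_eq[of "UNIV :: bool set" n] by simp

definition bits :: "nat set \<Rightarrow> nat list \<Rightarrow> bool list" where
  "bits L es = map (\<lambda>e. e \<in> L) es"

lemma bits_simps [simp]: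
  "length (bits L es) = length es"
  "bits L [] = []"
  "bits L (e # es) = (e \<in> L) # bits L es"
  "bits L (es @ es') = bits L es @ bits L es'"
  "set (bits L es) = (\<lambda>e. e \<in> L) ` set es"
  "i < length es \<Longrightarrow> bits L es ! i = (es ! i \<in> L)"
  by (simp_all add: bits_def)

lemma take_bits: "take n (bits L es) = bits L (take n es)"
  and drop_bits: "drop n (bits L es) = bits L (drop n es)"
  by (simp_all add: bits_def take_map drop_map)

lemma bits_cong: "(\<And>e. e \<in> set es \<Longrightarrow> e \<in> L \<longleftrightarrow> e \<in> L') \<Longrightarrow> bits L es = bits L' es"
  by (simp add: bits_def)

text \<open>Common core of cap, spider and Hadamard, whose outputs are all fresh: exactly one set
  \<open>L0\<close> of fresh labels spells \<open>ys\<close>, so the sum has a single term.\<close>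

lemma sum_fresh_bits:
  fixes g :: "bool list \<Rightarrow> bool list \<Rightarrow> complex"
  assumes "length ys = m" "L \<subseteq> {..<k}" "set ins \<subseteq> {..<k}"
  shows "(\<Sum>L'\<in>Pow {k..<k + m}. of_bool (bits (L \<union> L') [k..<k + m] = ys) *
    g (bits (L \<union> L') [k..<k + m]) (bits (L \<union> L') ins)) = g ys (bits L ins)"
proof -
  define L0 where "L0 = (\<lambda>i. k + i) ` {i. i < m \<and> ys ! i}"
  have L0: "L0 \<in> Pow {k..<k + m}" by (auto simp: L0_def)
  have iff: "bits (L \<union> L') [k..<k + m] = ys \<longleftrightarrow> L' = L0" if "L' \<in> Pow {k..<k + m}" for L'
  proof -
    have "bits (L \<union> L') [k..<k + m] = ys \<longleftrightarrow> (\<forall>i<m. (k + i \<in> L') = ys ! i)"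
      using assms by (auto simp: list_eq_iff_nth_eq)
    also have "\<dots> \<longleftrightarrow> L' = L0"
    proof
      assume *: "\<forall>i<m. (k + i \<in> L') = ys ! i"
      have "x \<in> L' \<longleftrightarrow> x \<in> L0" for x
      proof (cases "x \<in> {k..<k + m}")
        case True
        then obtain i where "x = k + i" "i < m"
          by (metis atLeastLessThan_iff le_Suc_ex nat_add_left_cancel_less)
        then show ?thesis using * by (auto simp: L0_def)
      next
        case False
        then show ?thesis using that by (auto simp: L0_def)
      qed
      then show "L' = L0" by auto
    qed (auto simp: L0_def)
    finally show ?thesis .
  qed
  have "(\<Sum>L'\<in>Pow {k..<k + m}. of_bool (bits (L \<union> L') [k..<k + m] = ys) *
      g (bits (L \<union> L') [k..<k + m]) (bits (L \<union> L') ins)) =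
    (\<Sum>L'\<in>Pow {k..<k + m}. if L' = L0 then
      g (bits (L \<union> L') [k..<k + m]) (bits (L \<union> L') ins) else 0)"
    by (rule sum.cong[OF refl]) (simp add: iff)
  also have "\<dots> = g (bits (L \<union> L0) [k..<k + m]) (bits (L \<union> L0) ins)"
    using L0 by (simp add: sum.delta)
  also have "bits (L \<union> L0) ins = bits L ins"
    using assms(3) L0 by (intro bits_cong) fastforce
  also have "bits (L \<union> L0) [k..<k + m] = ys"
    using iff[OF L0] by simp
  finally show ?thesis .
qed

text \<open>The set \<open>L\<close> fixes the bits of all older labels and only fresh labels are
  summed over; leaving \<open>L\<close> arbitrary is what lets the induction chain. In
  \<open>Comp\<close> the labelling forces the intermediate bit string, so the sum over
  \<open>zs\<close> disappears. In \<open>Par\<close> the labels created by \<open>D1\<close> count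
  as old ones while \<open>D2\<close> is expanded.\<close>

lemma interp_eq_state_sum:
  assumes "wf D" "length ins = nin D" "set ins \<subseteq> {..<k}" "build D ins k = (os, ns, k')"
    and "length ys = nout D" "L \<subseteq> {..<k}"
  shows "interp D ys (bits L ins) =
    (\<Sum>L'\<in>Pow {k..<k'}. of_bool (bits (L \<union> L') os = ys) * weights (L \<union> L') ns)"
  using assms
proof (induction D arbitrary: ins k os ns k' ys L)
  case (Comp D2 D1)
  obtain o1 n1 k1 where b1: "build D1 ins k = (o1, n1, k1)" by (cases "build D1 ins k")
  obtain o2 n2 k2 where b2: "build D2 o1 k1 = (o2, n2, k2)" by (cases "build D2 o1 k1")
  have eq: "os = o2" "ns = n1 @ n2" "k' = k2" using Comp.prems b1 b2 by auto
  have S1: "k \<le> k1" "length o1 = nout D1" "set o1 \<subseteq> {..<k1}" "\<forall>N\<in>set n1. node_edges N \<subseteq> {..<k1}"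
    using build_structure[OF _ _ _ b1] Comp.prems by auto
  have S2: "k1 \<le> k2"
    using build_structure[OF _ _ _ b2] Comp.prems S1 by auto
  have un: "{k..<k2} = {k..<k1} \<union> {k1..<k2}" using S1 S2 by auto
  have "interp (Comp D2 D1) ys (bits L ins) =
      (\<Sum>zs\<in>{zs. length zs = nout D1}. \<Sum>L1\<in>Pow {k..<k1}.
         of_bool (bits (L \<union> L1) o1 = zs) * (interp D2 ys zs * weights (L \<union> L1) n1))"
    using Comp.prems by (simp add: Comp.IH(2)[OF _ _ _ b1] sum_distrib_left mult.left_commute
        del: sum_of_bool_mult_eq sum_mult_of_bool_eq)
  also have "\<dots> = (\<Sum>L1\<in>Pow {k..<k1}. \<Sum>zs\<in>{zs. length zs = nout D1}.
         of_bool (bits (L \<union> L1) o1 = zs) * (interp D2 ys zs * weights (L \<union> L1) n1))"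
    by (rule sum.swap)
  also have "\<dots> = (\<Sum>L1\<in>Pow {k..<k1}. interp D2 ys (bits (L \<union> L1) o1) * weights (L \<union> L1) n1)"
  proof (rule sum.cong[OF refl])
    fix L1
    have "(\<Sum>zs\<in>{zs. length zs = nout D1}. of_bool (bits (L \<union> L1) o1 = zs) * (interp D2 ys zs * weights (L \<union> L1) n1))
      = (\<Sum>zs\<in>{zs. length zs = nout D1}. if bits (L \<union> L1) o1 = zs then interp D2 ys zs * weights (L \<union> L1) n1 else 0)"
      by (rule sum.cong) auto
    also have "\<dots> = interp D2 ys (bits (L \<union> L1) o1) * weights (L \<union> L1) n1"
      using S1(2) by (subst sum.delta'[OF finite_bool_lists]) auto
    finally show "(\<Sum>zs\<in>{zs. length zs = nout D1}. of_bool (bits (L \<union> L1) o1 = zs) * (interp D2 ys zs * weights (L \<union> L1) n1))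
      = interp D2 ys (bits (L \<union> L1) o1) * weights (L \<union> L1) n1" .
  qed
  also have "\<dots> = (\<Sum>L1\<in>Pow {k..<k1}. \<Sum>L2\<in>Pow {k1..<k2}.
      of_bool (bits (L \<union> (L1 \<union> L2)) o2 = ys) * weights (L \<union> (L1 \<union> L2)) (n1 @ n2))"
  proof (rule sum.cong[OF refl])
    fix L1 assume L1: "L1 \<in> Pow {k..<k1}"
    have sub: "L \<union> L1 \<subseteq> {..<k1}" using Comp.prems(6) L1 S1(1) by auto
    have "interp D2 ys (bits (L \<union> L1) o1) =
      (\<Sum>L2\<in>Pow {k1..<k2}. of_bool (bits (L \<union> L1 \<union> L2) o2 = ys) * weights (L \<union> L1 \<union> L2) n2)"
      using Comp.IH(1)[OF _ _ _ b2 _ sub] Comp.prems S1 by auto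
    moreover have w: "weights (L \<union> (L1 \<union> L2)) n1 = weights (L \<union> L1) n1" if "L2 \<in> Pow {k1..<k2}" for L2
      using that S1(4) by (intro weights_cong) fastforce
    ultimately show "interp D2 ys (bits (L \<union> L1) o1) * weights (L \<union> L1) n1 = (\<Sum>L2\<in>Pow {k1..<k2}.
      of_bool (bits (L \<union> (L1 \<union> L2)) o2 = ys) * weights (L \<union> (L1 \<union> L2)) (n1 @ n2))"
      by (simp only: sum_distrib_right)
        (rule sum.cong[OF refl], simp add: Un_assoc mult_ac)
  qed
  also have "\<dots> = (\<Sum>L'\<in>Pow {k..<k'}. of_bool (bits (L \<union> L') os = ys) * weights (L \<union> L') ns)"
    unfolding eq un by (rule sum_Pow_Un[symmetric]) auto
  finally show ?case .
next
  case (Par D1 D2)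
  let ?i1 = "take (nin D1) ins" and ?i2 = "drop (nin D1) ins"
  let ?y1 = "take (nout D1) ys" and ?y2 = "drop (nout D1) ys"
  obtain o1 n1 k1 where b1: "build D1 ?i1 k = (o1, n1, k1)" by (cases "build D1 ?i1 k")
  obtain o2 n2 k2 where b2: "build D2 ?i2 k1 = (o2, n2, k2)" by (cases "build D2 ?i2 k1")
  have eq: "os = o1 @ o2" "ns = n1 @ n2" "k' = k2" using Par.prems b1 b2 by auto
  have s1: "set ?i1 \<subseteq> {..<k}" using Par.prems(3) by (meson order_trans set_take_subset)
  have S1: "k \<le> k1" "length o1 = nout D1" "set o1 \<subseteq> {..<k1}" "\<forall>N\<in>set n1. node_edges N \<subseteq> {..<k1}"
    using build_structure[OF _ _ s1 b1] Par.prems by auto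
  have s2': "set ?i2 \<subseteq> {..<k}" using Par.prems(3) by (meson order_trans set_drop_subset)
  then have s2: "set ?i2 \<subseteq> {..<k1}" using S1(1) by auto
  have S2: "k1 \<le> k2"
    using build_structure[OF _ _ s2 b2] Par.prems S1 by auto
  have un: "{k..<k2} = {k..<k1} \<union> {k1..<k2}" using S1 S2 by auto
  have "interp (Par D1 D2) ys (bits L ins) =
     (\<Sum>L1\<in>Pow {k..<k1}. of_bool (bits (L \<union> L1) o1 = ?y1) * weights (L \<union> L1) n1 * interp D2 ?y2 (bits L ?i2))"
    using Par.prems s1 by (simp add: take_bits drop_bits Par.IH(1)[OF _ _ s1 b1] sum_distrib_right
        del: sum_of_bool_mult_eq sum_mult_of_bool_eq)
  also have "\<dots> = (\<Sum>L1\<in>Pow {k..<k1}. \<Sum>L2\<in>Pow {k1..<k2}.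
      of_bool (bits (L \<union> (L1 \<union> L2)) (o1 @ o2) = ys) * weights (L \<union> (L1 \<union> L2)) (n1 @ n2))"
  proof (rule sum.cong[OF refl])
    fix L1 assume L1: "L1 \<in> Pow {k..<k1}"
    have sub: "L \<union> L1 \<subseteq> {..<k1}" using Par.prems(6) L1 S1(1) by auto
    have "bits L ?i2 = bits (L \<union> L1) ?i2"
      using s2' L1 by (intro bits_cong) fastforce
    then have i2: "interp D2 ?y2 (bits L ?i2) =
      (\<Sum>L2\<in>Pow {k1..<k2}. of_bool (bits (L \<union> L1 \<union> L2) o2 = ?y2) * weights (L \<union> L1 \<union> L2) n2)"
      using Par.IH(2)[OF _ _ s2 b2 _ sub] Par.prems S1 by auto
    have w: "weights (L \<union> (L1 \<union> L2)) n1 = weights (L \<union> L1) n1" if "L2 \<in> Pow {k1..<k2}" for L2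
      using that S1(4) by (intro weights_cong) fastforce
    have b: "bits (L \<union> (L1 \<union> L2)) (o1 @ o2) = ys \<longleftrightarrow>
      bits (L \<union> L1) o1 = ?y1 \<and> bits (L \<union> (L1 \<union> L2)) o2 = ?y2" if "L2 \<in> Pow {k1..<k2}" for L2
    proof -
      have "bits (L \<union> (L1 \<union> L2)) o1 = bits (L \<union> L1) o1"
        using that S1(3) by (intro bits_cong) fastforce
      then show ?thesis
        using append_eq_conv_conj[of "bits (L \<union> L1) o1" "bits (L \<union> (L1 \<union> L2)) o2" ys] S1(2) by auto
    qed
    show "of_bool (bits (L \<union> L1) o1 = ?y1) * weights (L \<union> L1) n1 * interp D2 ?y2 (bits L ?i2) =
      (\<Sum>L2\<in>Pow {k1..<k2}.
      of_bool (bits (L \<union> (L1 \<union> L2)) (o1 @ o2) = ys) * weights (L \<union> (L1 \<union> L2)) (n1 @ n2))"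
      unfolding i2 sum_distrib_left
      by (rule sum.cong[OF refl]) (simp add: w b Un_assoc of_bool_conj mult_ac del: bits_simps(4))
  qed
  also have "\<dots> = (\<Sum>L'\<in>Pow {k..<k'}. of_bool (bits (L \<union> L') os = ys) * weights (L \<union> L') ns)"
    unfolding eq un by (rule sum_Pow_Un[symmetric]) auto
  finally show ?case .
next
  case Swap
  then obtain a b where "ins = [a, b]" by (auto simp: length_Suc_conv numeral_2_eq_2)
  with Swap show ?case by auto
next
  case Cup
  then obtain a b where "ins = [a, b]" by (auto simp: length_Suc_conv numeral_2_eq_2)
  with Cup show ?case by auto
next
  case Cap
  have os: "[k, Suc k] = [k..<k + 2]" by (simp add: upt_rec)
  have eq: "os = [k..<k + 2]" "ns = [NCap k (Suc k)]" "k' = k + 2" "ins = []"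
    unfolding os[symmetric] using Cap.prems by auto
  have w: "weight M (NCap k (Suc k)) = interp Cap (bits M [k..<k + 2]) (bits M [])" for M
    unfolding os[symmetric] by simp
  show ?case
    using sum_fresh_bits[of ys 2 L k "[]" "interp Cap"] Cap.prems
    unfolding eq by (simp only: w list.map prod_list.Cons prod_list.Nil mult_1_right) simp
next
  case (Z n m \<alpha>)
  have eq: "os = [k..<k + m]" "ns = [NZ ins [k..<k + m] \<alpha>]" "k' = k + m"
    using Z.prems by auto
  have w: "weight M (NZ ins os \<alpha>) = interp (Z n m \<alpha>) (bits M os) (bits M ins)" for M os
    by (auto simp: ball_Un)
  show ?case
    using sum_fresh_bits[of ys m L k ins "interp (Z n m \<alpha>)"] Z.prems
    unfolding eq by (simp only: w list.map prod_list.Cons prod_list.Nil mult_1_right) simp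
next
  case H
  then obtain a where a: "ins = [a]" by (auto simp: length_Suc_conv)
  have eq: "os = [k..<k + 1]" "ns = [NH a k]" "k' = k + 1"
    using H.prems a by auto
  have w: "weight M (NH a k) = interp H (bits M [k..<k + 1]) (bits M [a])" for M
    by auto
  show ?case
    using sum_fresh_bits[of ys 1 L k "[a]" "interp H"] H.prems
    unfolding eq a by (simp only: w list.map prod_list.Cons prod_list.Nil mult_1_right) simp
qed auto

section \<open>Cutting disconnected diagrams\<close>

text \<open>Erases from a term everything outside a part of its graph, with \<open>ins\<close> and
  \<open>k\<close> following the labelling made by \<open>build\<close>. Edges are selected by
  \<open>P\<close>, nodes by \<open>Q\<close>; the latter is separate because \<open>P\<close> says
  nothing about a spider without edges. A swap of which only one wire is kept becomes a plain
  wire.\<close>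

fun restrict_diag :: "(nat \<Rightarrow> bool) \<Rightarrow> (node \<Rightarrow> bool) \<Rightarrow> zx \<Rightarrow> nat list \<Rightarrow> nat \<Rightarrow> zx" where
  "restrict_diag P Q Empty ins k = Empty"
| "restrict_diag P Q Id ins k = (if P (ins ! 0) then Id else Empty)"
| "restrict_diag P Q Swap ins k =
     (if P (ins ! 0) \<and> P (ins ! 1) then Swap
      else if P (ins ! 0) \<or> P (ins ! 1) then Id else Empty)"
| "restrict_diag P Q Cup ins k = (if Q (NCup (ins ! 0) (ins ! 1)) then Cup else Empty)"
| "restrict_diag P Q Cap ins k = (if Q (NCap k (Suc k)) then Cap else Empty)"
| "restrict_diag P Q (Z n m \<alpha>) ins k = (if Q (NZ ins [k..<k + m] \<alpha>) then Z n m \<alpha> else Empty)"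
| "restrict_diag P Q H ins k = (if Q (NH (ins ! 0) k) then H else Empty)"
| "restrict_diag P Q (Comp D2 D1) ins k =
     (let (o1, n1, k1) = build D1 ins k
      in Comp (restrict_diag P Q D2 o1 k1) (restrict_diag P Q D1 ins k))"
| "restrict_diag P Q (Par D1 D2) ins k =
     (let (o1, n1, k1) = build D1 (take (nin D1) ins) k
      in Par (restrict_diag P Q D1 (take (nin D1) ins) k)
             (restrict_diag P Q D2 (drop (nin D1) ins) k1))"

lemma map_node_cong: "(\<And>e. e \<in> node_edges N \<Longrightarrow> g e = h e) \<Longrightarrow> map_node g N = map_node h N"
  by (cases N) auto

text \<open>\<open>build\<close> runs on the erased term in lockstep with the original, and
  \<open>h\<close> translates the surviving labels into the gap-free ones of the erased term. The
  prescribed renaming \<open>g\<close> of old labels and the start \<open>j\<close> are arbitrary,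
  both to chain through \<open>Comp\<close> and \<open>Par\<close> and to place two complementary
  restrictions in adjacent blocks of labels.\<close>

lemma build_restrict_diag:
  assumes "wf D" "length ins = nin D" "set ins \<subseteq> {..<k}" "build D ins k = (os, ns, k')"
    and "\<And>N. N \<in> set ns \<Longrightarrow> Q N \<Longrightarrow> node_edges N \<subseteq> Collect P"
    and "\<And>N. N \<in> set ns \<Longrightarrow> \<not> Q N \<Longrightarrow> node_edges N \<inter> Collect P = {}"
  shows "wf (restrict_diag P Q D ins k) \<and>
    nin (restrict_diag P Q D ins k) = length (filter P ins) \<and>
    nout (restrict_diag P Q D ins k) = length (filter P os) \<and>
    (\<exists>h j'. (\<forall>l<k. h l = g l) \<and> bij_betw h ({k..<k'} \<inter> Collect P) {j..<j'} \<and> j \<le> j' \<and>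
      build (restrict_diag P Q D ins k) (map g (filter P ins)) j =
        (map h (filter P os), map (map_node h) (filter Q ns), j'))"
  using assms
proof (induction D arbitrary: ins k os ns k' g j)
  case (Comp D2 D1)
  obtain o1 n1 k1 where b1: "build D1 ins k = (o1, n1, k1)" by (cases "build D1 ins k")
  obtain o2 n2 k2 where b2: "build D2 o1 k1 = (o2, n2, k2)" by (cases "build D2 o1 k1")
  have eq: "os = o2" "ns = n1 @ n2" "k' = k2" using Comp.prems b1 b2 by auto
  have S1: "k \<le> k1" "length o1 = nout D1" "set o1 \<subseteq> {..<k1}" "\<forall>N\<in>set n1. node_edges N \<subseteq> {..<k1}"
    using build_structure[OF _ _ _ b1] Comp.prems by auto
  have S2: "k1 \<le> k2"
    using build_structure[OF _ _ _ b2] Comp.prems S1 by auto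
  let ?r1 = "restrict_diag P Q D1 ins k" and ?r2 = "restrict_diag P Q D2 o1 k1"
  have I1: "wf ?r1" "nin ?r1 = length (filter P ins)" "nout ?r1 = length (filter P o1)"
    and "\<exists>h j'. (\<forall>l<k. h l = g l) \<and> bij_betw h ({k..<k1} \<inter> Collect P) {j..<j'} \<and> j \<le> j' \<and>
      build ?r1 (map g (filter P ins)) j = (map h (filter P o1), map (map_node h) (filter Q n1), j')"
    using Comp.IH(2)[OF _ _ _ b1, of g j] Comp.prems eq by auto
  then obtain h1 j1 where h1: "\<forall>l<k. h1 l = g l" "bij_betw h1 ({k..<k1} \<inter> Collect P) {j..<j1}" "j \<le> j1"
    "build ?r1 (map g (filter P ins)) j = (map h1 (filter P o1), map (map_node h1) (filter Q n1), j1)"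
    by blast
  have I2: "wf ?r2" "nin ?r2 = length (filter P o1)" "nout ?r2 = length (filter P o2)"
    and "\<exists>h j'. (\<forall>l<k1. h l = h1 l) \<and> bij_betw h ({k1..<k2} \<inter> Collect P) {j1..<j'} \<and> j1 \<le> j' \<and>
      build ?r2 (map h1 (filter P o1)) j1 = (map h (filter P o2), map (map_node h) (filter Q n2), j')"
    using Comp.IH(1)[OF _ _ _ b2, of h1 j1] Comp.prems eq S1 by auto
  then obtain h2 j2 where h2: "\<forall>l<k1. h2 l = h1 l" "bij_betw h2 ({k1..<k2} \<inter> Collect P) {j1..<j2}" "j1 \<le> j2"
    "build ?r2 (map h1 (filter P o1)) j1 = (map h2 (filter P o2), map (map_node h2) (filter Q n2), j2)"
    by blast
  have n1: "map (map_node h2) (filter Q n1) = map (map_node h1) (filter Q n1)"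
    using S1(4) h2(1) by (intro map_cong refl map_node_cong) auto
  have "bij_betw h2 ({k..<k1} \<inter> Collect P) {j..<j1}"
    using h1(2) h2(1) by (subst bij_betw_cong[where g = h1]) auto
  then have "bij_betw h2 (({k..<k1} \<inter> Collect P) \<union> ({k1..<k2} \<inter> Collect P)) ({j..<j1} \<union> {j1..<j2})"
    by (rule bij_betw_combine[OF _ h2(2)]) auto
  moreover have "({k..<k1} \<inter> Collect P) \<union> ({k1..<k2} \<inter> Collect P) = {k..<k2} \<inter> Collect P"
    using S1(1) S2 by auto
  moreover have "{j..<j1} \<union> {j1..<j2} = {j..<j2}" using h1(3) h2(3) by auto
  ultimately have bij: "bij_betw h2 ({k..<k2} \<inter> Collect P) {j..<j2}" by simp
  have r: "restrict_diag P Q (Comp D2 D1) ins k = Comp ?r2 ?r1" by (simp add: b1)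
  have hg: "\<forall>l<k. h2 l = g l" using h1(1) h2(1) S1(1) by (metis order_less_le_trans)
  have jj: "j \<le> j2" using h1(3) h2(3) by simp
  have bd: "build (Comp ?r2 ?r1) (map g (filter P ins)) j =
      (map h2 (filter P o2), map (map_node h2) (filter Q (n1 @ n2)), j2)"
    using h1(4) h2(4) n1 by simp
  have "wf (Comp ?r2 ?r1)" "nin (Comp ?r2 ?r1) = length (filter P ins)"
    "nout (Comp ?r2 ?r1) = length (filter P o2)"
    using I1 I2 by simp_all
  then show ?case unfolding r eq using hg bij jj bd by blast
next
  case (Par D1 D2)
  let ?i1 = "take (nin D1) ins" and ?i2 = "drop (nin D1) ins"
  obtain o1 n1 k1 where b1: "build D1 ?i1 k = (o1, n1, k1)" by (cases "build D1 ?i1 k")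
  obtain o2 n2 k2 where b2: "build D2 ?i2 k1 = (o2, n2, k2)" by (cases "build D2 ?i2 k1")
  have eq: "os = o1 @ o2" "ns = n1 @ n2" "k' = k2" using Par.prems b1 b2 by auto
  have s1: "set ?i1 \<subseteq> {..<k}" using Par.prems(3) by (meson order_trans set_take_subset)
  have S1: "k \<le> k1" "length o1 = nout D1" "set o1 \<subseteq> {..<k1}" "\<forall>N\<in>set n1. node_edges N \<subseteq> {..<k1}"
    using build_structure[OF _ _ s1 b1] Par.prems by auto
  have s2': "set ?i2 \<subseteq> {..<k}" using Par.prems(3) by (meson order_trans set_drop_subset)
  then have s2: "set ?i2 \<subseteq> {..<k1}" using S1(1) by auto
  have S2: "k1 \<le> k2"
    using build_structure[OF _ _ s2 b2] Par.prems S1 by auto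
  let ?r1 = "restrict_diag P Q D1 ?i1 k" and ?r2 = "restrict_diag P Q D2 ?i2 k1"
  have I1: "wf ?r1" "nin ?r1 = length (filter P ?i1)" "nout ?r1 = length (filter P o1)"
    and "\<exists>h j'. (\<forall>l<k. h l = g l) \<and> bij_betw h ({k..<k1} \<inter> Collect P) {j..<j'} \<and> j \<le> j' \<and>
      build ?r1 (map g (filter P ?i1)) j = (map h (filter P o1), map (map_node h) (filter Q n1), j')"
    using Par.IH(1)[OF _ _ s1 b1, of g j] Par.prems eq by auto
  then obtain h1 j1 where h1: "\<forall>l<k. h1 l = g l" "bij_betw h1 ({k..<k1} \<inter> Collect P) {j..<j1}" "j \<le> j1"
    "build ?r1 (map g (filter P ?i1)) j = (map h1 (filter P o1), map (map_node h1) (filter Q n1), j1)"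
    by blast
  have I2: "wf ?r2" "nin ?r2 = length (filter P ?i2)" "nout ?r2 = length (filter P o2)"
    and "\<exists>h j'. (\<forall>l<k1. h l = h1 l) \<and> bij_betw h ({k1..<k2} \<inter> Collect P) {j1..<j'} \<and> j1 \<le> j' \<and>
      build ?r2 (map h1 (filter P ?i2)) j1 = (map h (filter P o2), map (map_node h) (filter Q n2), j')"
    using Par.IH(2)[OF _ _ s2 b2, of h1 j1] Par.prems eq S1 by auto
  then obtain h2 j2 where h2: "\<forall>l<k1. h2 l = h1 l" "bij_betw h2 ({k1..<k2} \<inter> Collect P) {j1..<j2}" "j1 \<le> j2"
    "build ?r2 (map h1 (filter P ?i2)) j1 = (map h2 (filter P o2), map (map_node h2) (filter Q n2), j2)"
    by blast
  have n1: "map (map_node h2) (filter Q n1) = map (map_node h1) (filter Q n1)"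
    using S1(4) h2(1) by (intro map_cong refl map_node_cong) auto
  have o1: "map h2 (filter P o1) = map h1 (filter P o1)"
    using S1(3) h2(1) by auto
  have g2: "map h1 (filter P ?i2) = map g (filter P ?i2)"
    using s2' h1(1) by auto
  have "bij_betw h2 ({k..<k1} \<inter> Collect P) {j..<j1}"
    using h1(2) h2(1) by (subst bij_betw_cong[where g = h1]) auto
  then have "bij_betw h2 (({k..<k1} \<inter> Collect P) \<union> ({k1..<k2} \<inter> Collect P)) ({j..<j1} \<union> {j1..<j2})"
    by (rule bij_betw_combine[OF _ h2(2)]) auto
  moreover have "({k..<k1} \<inter> Collect P) \<union> ({k1..<k2} \<inter> Collect P) = {k..<k2} \<inter> Collect P"
    using S1(1) S2 by auto
  moreover have "{j..<j1} \<union> {j1..<j2} = {j..<j2}" using h1(3) h2(3) by auto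
  ultimately have bij: "bij_betw h2 ({k..<k2} \<inter> Collect P) {j..<j2}" by simp
  have r: "restrict_diag P Q (Par D1 D2) ins k = Par ?r1 ?r2" by (simp add: b1)
  have fi: "filter P ins = filter P ?i1 @ filter P ?i2"
    by (metis append_take_drop_id filter_append)
  have hg: "\<forall>l<k. h2 l = g l" using h1(1) h2(1) S1(1) by (metis order_less_le_trans)
  have jj: "j \<le> j2" using h1(3) h2(3) by simp
  have bd: "build (Par ?r1 ?r2) (map g (filter P ins)) j =
      (map h2 (filter P (o1 @ o2)), map (map_node h2) (filter Q (n1 @ n2)), j2)"
    using h1(4) h2(4) n1 o1 g2 I1(2) unfolding fi by simp
  have "wf (Par ?r1 ?r2)" "nin (Par ?r1 ?r2) = length (filter P ins)"
    "nout (Par ?r1 ?r2) = length (filter P (o1 @ o2))"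
    unfolding fi using I1 I2 by simp_all
  then show ?case unfolding r eq using hg bij jj bd by blast
next
  case Empty
  then show ?case by (auto simp: bij_betw_def intro!: exI[of _ g] exI[of _ j])
next
  case Id
  then obtain a where "ins = [a]" by (auto simp: length_Suc_conv)
  with Id show ?case by (auto simp: bij_betw_def intro!: exI[of _ g] exI[of _ j])
next
  case Swap
  then obtain a b where "ins = [a, b]" by (auto simp: length_Suc_conv numeral_2_eq_2)
  with Swap show ?case by (auto simp: bij_betw_def intro!: exI[of _ g] exI[of _ j])
next
  case Cup
  then obtain a b where a: "ins = [a, b]" by (auto simp: length_Suc_conv numeral_2_eq_2)
  have eq: "os = []" "ns = [NCup a b]" "k' = k" using Cup.prems a by auto
  have "P a = Q (NCup a b)" "P b = Q (NCup a b)"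
    using Cup.prems(5,6)[of "NCup a b"] eq by auto
  then show ?case unfolding a eq by (auto simp: bij_betw_def intro!: exI[of _ g] exI[of _ j])
next
  case Cap
  \<comment> \<open>Fresh labels keep their offset: \<open>k + i\<close> becomes
    \<open>j + i\<close>.\<close>
  define h where "h l = (if l < k then g l else j + (l - k))" for l
  have eq: "os = [k, Suc k]" "ns = [NCap k (Suc k)]" "k' = k + 2" "ins = []" using Cap.prems by auto
  show ?case
  proof (cases "Q (NCap k (Suc k))")
    case True
    then have "P k" "P (Suc k)" using Cap.prems(5) eq by auto
    moreover from this have "{k..<k + 2} \<inter> Collect P = {k, Suc k}" by (auto simp: le_Suc_eq less_Suc_eq numeral_2_eq_2)
    moreover have "bij_betw h {k, Suc k} {j..<j + 2}"
      unfolding bij_betw_def inj_on_def by (auto simp: h_def)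
    ultimately show ?thesis unfolding eq
      using True by (auto intro!: exI[of _ h] exI[of _ "j + 2"] simp: h_def)
  next
    case False
    then have "\<not> P k" "\<not> P (Suc k)" using Cap.prems(6) eq by auto
    moreover from this have "{k..<k + 2} \<inter> Collect P = {}" by (auto simp: le_Suc_eq less_Suc_eq numeral_2_eq_2)
    ultimately show ?thesis unfolding eq
      using False by (auto simp: bij_betw_def intro!: exI[of _ g] exI[of _ j])
  qed
next
  case (Z n m \<alpha>)
  define h where "h l = (if l < k then g l else j + (l - k))" for l
  let ?N = "NZ ins [k..<k + m] \<alpha>"
  have eq: "os = [k..<k + m]" "ns = [?N]" "k' = k + m" using Z.prems by auto
  show ?case
  proof (cases "Q ?N")
    case True
    then have P: "\<forall>l\<in>set ins \<union> {k..<k + m}. P l" using Z.prems(5)[of ?N] eq by auto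
    then have f: "filter P ins = ins" "filter P [k..<k + m] = [k..<k + m]" by auto
    have "{k..<k + m} \<inter> Collect P = {k..<k + m}" using P by auto
    moreover have "map h [k..<k + m] = [j..<j + m]"
      by (rule nth_equalityI) (auto simp: h_def)
    moreover have "bij_betw h {k..<k + m} {j..<j + m}"
      by (rule bij_betw_byWitness[where f' = "\<lambda>l. k + (l - j)"]) (auto simp: h_def)
    moreover have "map h ins = map g ins" using Z.prems(3) by (auto simp: h_def)
    ultimately show ?thesis unfolding eq
      using True f Z.prems(2) by (auto intro!: exI[of _ h] exI[of _ "j + m"] simp: h_def[of l for l])
  next
    case False
    then have P: "\<forall>l\<in>set ins \<union> {k..<k + m}. \<not> P l" using Z.prems(6)[of ?N] eq by auto
    then have f: "filter P ins = []" "filter P [k..<k + m] = []" by (auto simp: filter_empty_conv)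
    have "{k..<k + m} \<inter> Collect P = {}" using P by auto
    then show ?thesis unfolding eq
      using False f by (auto simp: bij_betw_def intro!: exI[of _ g] exI[of _ j])
  qed
next
  case H
  define h where "h l = (if l < k then g l else j + (l - k))" for l
  obtain a where a: "ins = [a]" using H.prems by (auto simp: length_Suc_conv)
  then have ak: "a < k" using H.prems by auto
  have eq: "os = [k]" "ns = [NH a k]" "k' = Suc k" using H.prems a by auto
  show ?case
  proof (cases "Q (NH a k)")
    case True
    then have "P k" "P a" using H.prems(5) eq by auto
    moreover from this have "{k..<Suc k} \<inter> Collect P = {k}" by auto
    moreover have "bij_betw h {k} {j..<Suc j}"
      unfolding bij_betw_def inj_on_def by (auto simp: h_def)
    ultimately show ?thesis unfolding eq a
      using True ak by (auto intro!: exI[of _ h] exI[of _ "Suc j"] simp: h_def)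
  next
    case False
    then have "\<not> P k" "\<not> P a" using H.prems(6) eq by auto
    moreover from this have "{k..<Suc k} \<inter> Collect P = {}" by auto
    ultimately show ?thesis unfolding eq a
      using False by (auto simp: bij_betw_def intro!: exI[of _ g] exI[of _ j])
  qed
qed

section \<open>Permutation diagrams realize every reordering of wires\<close>

lemma perm_diag_wf: "perm_diag \<sigma> \<Longrightarrow> wf \<sigma>"
  by (induction rule: perm_diag.induct) auto

definition rewires :: "nat list \<Rightarrow> nat list \<Rightarrow> bool" where
  "rewires xs ys \<longleftrightarrow> (\<exists>\<sigma>. perm_diag \<sigma> \<and> nin \<sigma> = length xs \<and> nout \<sigma> = length ys \<and>
     (\<forall>k. build \<sigma> xs k = (ys, [], k)))"

lemma rewires_Cons: "rewires xs ys \<Longrightarrow> rewires (x # xs) (x # ys)"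
  unfolding rewires_def
proof (elim exE conjE)
  fix \<sigma> assume "perm_diag \<sigma>" "nin \<sigma> = length xs" "nout \<sigma> = length ys" "\<forall>k. build \<sigma> xs k = (ys, [], k)"
  then show "\<exists>\<sigma>. perm_diag \<sigma> \<and> nin \<sigma> = length (x # xs) \<and> nout \<sigma> = length (x # ys) \<and>
     (\<forall>k. build \<sigma> (x # xs) k = (x # ys, [], k))"
    by (intro exI[of _ "Par Id \<sigma>"]) (auto intro: perm_diag.intros)
qed

lemma rewires_refl: "rewires xs xs"
proof (induction xs)
  case Nil
  show ?case unfolding rewires_def by (intro exI[of _ Empty]) (auto intro: perm_diag.intros)
qed (rule rewires_Cons)

lemma rewires_trans: "rewires xs ys \<Longrightarrow> rewires ys zs \<Longrightarrow> rewires xs zs"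
  unfolding rewires_def
proof (elim exE conjE)
  fix \<sigma> \<tau> assume "perm_diag \<sigma>" "nin \<sigma> = length xs" "nout \<sigma> = length ys" "\<forall>k. build \<sigma> xs k = (ys, [], k)"
    "perm_diag \<tau>" "nin \<tau> = length ys" "nout \<tau> = length zs" "\<forall>k. build \<tau> ys k = (zs, [], k)"
  then show "\<exists>\<sigma>. perm_diag \<sigma> \<and> nin \<sigma> = length xs \<and> nout \<sigma> = length zs \<and>
     (\<forall>k. build \<sigma> xs k = (zs, [], k))"
    by (intro exI[of _ "Comp \<tau> \<sigma>"]) (auto intro: perm_diag.intros)
qed

lemma rewires_swap: "rewires (x # y # xs) (y # x # xs)"
proof -
  from rewires_refl[of xs] obtain \<sigma> where "perm_diag \<sigma>" "nin \<sigma> = length xs" "nout \<sigma> = length xs"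
    "\<forall>k. build \<sigma> xs k = (xs, [], k)" unfolding rewires_def by auto
  then show ?thesis unfolding rewires_def
    by (intro exI[of _ "Par Swap \<sigma>"]) (auto intro: perm_diag.intros simp: numeral_2_eq_2)
qed

text \<open>Insertion by adjacent transpositions: the head wire is moved past \<open>us\<close> one
  swap at a time.\<close>

lemma rewires_mset_eq: "mset xs = mset ys \<Longrightarrow> rewires xs ys"
proof (induction xs arbitrary: ys)
  case Nil
  then show ?case by (simp add: rewires_refl)
next
  case (Cons x xs)
  then have "x \<in> set ys" by (metis list.set_intros(1) set_mset_mset)
  then obtain us vs where ys: "ys = us @ x # vs" by (auto dest: split_list)
  have "rewires xs (us @ vs)" using Cons ys by simp
  then have "rewires (x # xs) (x # us @ vs)" by (rule rewires_Cons)
  moreover have "rewires (x # us @ vs) (us @ x # vs)"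
  proof (induction us)
    case (Cons u us)
    then show ?case using rewires_trans[OF rewires_swap rewires_Cons] by simp
  qed (simp add: rewires_refl)
  ultimately show ?case unfolding ys by (rule rewires_trans)
qed

text \<open>Moves nonemptiness from the labelling under which a part occurs inside a larger diagram
  to the canonical labelling that \<open>graph_of\<close> uses.\<close>

lemma build_length_nodes:
  "length (fst (snd (build D ins k))) = length (fst (snd (build D ins' k')))"
proof (induction D arbitrary: ins ins' k k')
  case (Comp D2 D1)
  then show ?case by (simp add: case_prod_beta) metis
next
  case (Par D1 D2)
  then show ?case by (simp add: case_prod_beta) metis
qed auto

lemma nonempty_diagI:
  assumes "nin D \<noteq> 0 \<or> fst (snd (build D ins k)) \<noteq> []"
  shows "nonempty_diag D"
proof (cases "nin D = 0")
  case True
  then have "fst (snd (build D [0..<nin D] (nin D))) \<noteq> []"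
    using assms build_length_nodes[of D ins k "[0..<nin D]" "nin D"] by auto
  then show ?thesis
    by (auto simp: nonempty_diag_def nodes_def graph_of_def case_prod_beta Let_def)
next
  case False
  then have "inputs D \<noteq> []" by (auto simp: inputs_def graph_of_def case_prod_beta Let_def)
  then show ?thesis
    by (auto simp: nonempty_diag_def edges_def)
qed

lemma set_upt_subset: "set [0..<n] \<subseteq> {..<n}"
  by auto

text \<open>No label is skipped: those below \<open>nin D\<close> are inputs, and every later one
  was created as the output of a node.\<close>

lemma edges_eq_labels:
  assumes "wf D" "build D [0..<nin D] (nin D) = (os, ns, K)"
  shows "edges D = {..<K}"
proof -
  have S: "nin D \<le> K" "set os \<subseteq> {..<K}" "\<forall>N\<in>set ns. node_edges N \<subseteq> {..<K}"
    "concat (map node_outs ns) = [nin D..<K]"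
    using build_structure[OF assms(1) _ set_upt_subset assms(2)] by auto
  have E: "edges D = {0..<nin D} \<union> set os \<union> (\<Union>N\<in>set ns. node_edges N)"
    using assms(2) by (simp add: edges_def inputs_def outputs_def nodes_def graph_of_def)
  have A: "{nin D..<K} \<subseteq> (\<Union>N\<in>set ns. node_edges N)"
  proof
    fix l assume "l \<in> {nin D..<K}"
    then have "l \<in> set (concat (map node_outs ns))" using S(4) by simp
    then show "l \<in> (\<Union>N\<in>set ns. node_edges N)" by (auto simp: node_edges_eq)
  qed
  have B: "(\<Union>N\<in>set ns. node_edges N) \<subseteq> {..<K}" using S(3) by blast
  have C: "{0..<nin D} \<subseteq> {..<K}" using S(1) by auto
  have "{..<K} \<subseteq> {0..<nin D} \<union> {nin D..<K}" by auto
  also have "\<dots> \<subseteq> edges D" unfolding E using A by (simp add: le_supI1 le_supI2)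
  finally show ?thesis using B C S(2) unfolding E by (intro equalityI Un_least)
qed

text \<open>\<open>F\<close> is a union of components. If it missed a label, erasing its complement
  and erasing \<open>F\<close> itself would give two nonempty diagrams; sorting the wires before and
  unsorting them after their parallel composition rebuilds the graph of \<open>D\<close> up to
  renaming, which connectedness forbids. The second alternative for \<open>F\<close> serves the
  choice \<open>F = {}\<close>, where the first factor consists of edgeless spiders alone.\<close>

lemma connected_diag_no_cut:
  assumes "wf D" "connected_diag D" "build D [0..<nin D] (nin D) = (os, ns, K)"
    and sep: "\<And>N. N \<in> set ns \<Longrightarrow> node_edges N \<subseteq> F \<or> node_edges N \<inter> F = {}"
    and F: "F \<inter> {..<K} \<noteq> {} \<or> (\<exists>N\<in>set ns. node_edges N = {})"
  shows "{..<K} \<subseteq> F"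
proof (rule ccontr)
  assume nF: "\<not> {..<K} \<subseteq> F"
  define n where "n = nin D"
  define P1 P2 where "P1 l \<longleftrightarrow> l \<in> F" and "P2 l \<longleftrightarrow> l \<notin> F" for l
  define Q1 Q2 where "Q1 N \<longleftrightarrow> node_edges N \<subseteq> F" and "Q2 N \<longleftrightarrow> \<not> node_edges N \<subseteq> F" for N
  define D1 D2 where "D1 = restrict_diag P1 Q1 D [0..<n] n" and "D2 = restrict_diag P2 Q2 D [0..<n] n"
  let ?ins = "[0..<n]"
  have b: "build D ?ins n = (os, ns, K)" using assms(3) by (simp add: n_def)
  have S: "n \<le> K" "length os = nout D" "set os \<subseteq> {..<K}" "\<forall>N\<in>set ns. node_edges N \<subseteq> {..<K}"
    "concat (map node_outs ns) = [n..<K]"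
    using build_structure[OF assms(1) _ set_upt_subset b] by (auto simp: n_def)
  have r1: "wf D1" "nin D1 = length (filter P1 ?ins)" "nout D1 = length (filter P1 os)"
    and "\<exists>h j'. (\<forall>l<n. h l = id l) \<and> bij_betw h ({n..<K} \<inter> Collect P1) {n..<j'} \<and> n \<le> j' \<and>
      build D1 (map id (filter P1 ?ins)) n = (map h (filter P1 os), map (map_node h) (filter Q1 ns), j')"
    using build_restrict_diag[OF assms(1) _ set_upt_subset b, where P = P1 and Q = Q1 and g = id and j = n] sep
    unfolding D1_def n_def P1_def Q1_def by auto
  then obtain h1 j1 where h1: "\<forall>l<n. h1 l = l" "bij_betw h1 ({n..<K} \<inter> Collect P1) {n..<j1}" "n \<le> j1"
    "build D1 (filter P1 ?ins) n = (map h1 (filter P1 os), map (map_node h1) (filter Q1 ns), j1)"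
    by auto
  have N1: "node_edges N \<subseteq> Collect P2" if "N \<in> set ns" "Q2 N" for N
    using that sep[of N] by (auto simp: P2_def Q2_def)
  have N2: "node_edges N \<inter> Collect P2 = {}" if "N \<in> set ns" "\<not> Q2 N" for N
    using that by (auto simp: P2_def Q2_def)
  \<comment> \<open>The second part is labelled from \<open>j1\<close> on, where the first stops,
    because \<open>Par D1 D2\<close> hands the next fresh label over in this way.\<close>
  have r2: "wf D2" "nin D2 = length (filter P2 ?ins)" "nout D2 = length (filter P2 os)"
    and "\<exists>h j'. (\<forall>l<n. h l = id l) \<and> bij_betw h ({n..<K} \<inter> Collect P2) {j1..<j'} \<and> j1 \<le> j' \<and>
      build D2 (map id (filter P2 ?ins)) j1 = (map h (filter P2 os), map (map_node h) (filter Q2 ns), j')"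
    using build_restrict_diag[OF assms(1) _ set_upt_subset b, OF _ N1 N2, where g = id and j = j1]
    unfolding D2_def by (simp_all add: n_def)
  then obtain h2 j2 where h2: "\<forall>l<n. h2 l = l" "bij_betw h2 ({n..<K} \<inter> Collect P2) {j1..<j2}" "j1 \<le> j2"
    "build D2 (filter P2 ?ins) j1 = (map h2 (filter P2 os), map (map_node h2) (filter Q2 ns), j2)"
    by auto
  \<comment> \<open>Glues the two renamings. Both are the identity on the diagram inputs, so the
    composite has literally the same input list.\<close>
  define f where "f l = (if l \<in> F then h1 l else h2 l)" for l
  have ne1: "nonempty_diag D1"
  proof -
    have "(\<exists>l\<in>set ?ins. P1 l) \<or> (\<exists>N\<in>set ns. Q1 N)"
    proof (cases "F \<inter> {..<K} = {}")
      case False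
      then obtain l where l: "l \<in> F" "l < K" by auto
      show ?thesis
      proof (cases "l < n")
        case False
        then have "l \<in> set (concat (map node_outs ns))" using l S(5) by simp
        then obtain N where "N \<in> set ns" "l \<in> node_edges N" by (auto simp: node_edges_eq)
        then show ?thesis using sep[of N] l by (auto simp: Q1_def)
      qed (use l in \<open>auto simp: P1_def\<close>)
    qed (use F in \<open>auto simp: Q1_def\<close>)
    then have "nin D1 \<noteq> 0 \<or> fst (snd (build D1 (filter P1 ?ins) n)) \<noteq> []"
      unfolding r1 h1(4) by (auto simp: filter_empty_conv)
    then show ?thesis by (rule nonempty_diagI)
  qed
  have ne2: "nonempty_diag D2"
  proof -
    obtain l where l: "l \<notin> F" "l < K" using nF by auto
    have "(\<exists>l\<in>set ?ins. P2 l) \<or> (\<exists>N\<in>set ns. Q2 N)"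
    proof (cases "l < n")
      case False
      then have "l \<in> set (concat (map node_outs ns))" using l S(5) by simp
      then obtain N where "N \<in> set ns" "l \<in> node_edges N" by (auto simp: node_edges_eq)
      then show ?thesis using l by (auto simp: Q2_def)
    qed (use l in \<open>auto simp: P2_def\<close>)
    then have "nin D2 \<noteq> 0 \<or> fst (snd (build D2 (filter P2 ?ins) j1)) \<noteq> []"
      unfolding r2 h2(4) by (auto simp: filter_empty_conv)
    then show ?thesis by (rule nonempty_diagI)
  qed
  have mset_split: "mset xs = mset (filter P1 xs @ filter P2 xs)" for xs
    unfolding P1_def P2_def by (simp add: mset_filter)
  obtain \<sigma> where \<sigma>: "perm_diag \<sigma>" "nin \<sigma> = n" "nout \<sigma> = length (filter P1 ?ins @ filter P2 ?ins)"
    "\<forall>k. build \<sigma> ?ins k = (filter P1 ?ins @ filter P2 ?ins, [], k)"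
    using rewires_mset_eq[OF mset_split[of ?ins]] unfolding rewires_def by auto
  \<comment> \<open>The wires that reach the final permutation already carry renamed labels, hence
    the \<open>map f\<close> on both sides.\<close>
  have "mset (map f (filter P1 os @ filter P2 os)) = mset (map f os)"
    using mset_split[of os] by (metis mset_map)
  then obtain \<sigma>' where \<sigma>': "perm_diag \<sigma>'" "nin \<sigma>' = length (filter P1 os @ filter P2 os)"
    "\<forall>k. build \<sigma>' (map f (filter P1 os @ filter P2 os)) k = (map f os, [], k)"
    using rewires_mset_eq unfolding rewires_def by fastforce
  have f1: "map h1 (filter P1 os) = map f (filter P1 os)" by (auto simp: f_def P1_def)
  have f2: "map h2 (filter P2 os) = map f (filter P2 os)" by (auto simp: f_def P2_def)
  have g1: "map (map_node h1) (filter Q1 ns) = map (map_node f) (filter Q1 ns)"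
    by (intro map_cong refl map_node_cong) (auto simp: f_def Q1_def)
  have g2: "map (map_node h2) (filter Q2 ns) = map (map_node f) (filter Q2 ns)"
  proof (intro map_cong refl map_node_cong)
    fix N e assume "N \<in> set (filter Q2 ns)" "e \<in> node_edges N"
    then have "e \<notin> F" using sep[of N] by (auto simp: Q2_def)
    then show "h2 e = f e" by (simp add: f_def)
  qed
  let ?D = "Comp \<sigma>' (Comp (Par D1 D2) \<sigma>)"
  have wf: "wf ?D" using perm_diag_wf \<sigma> \<sigma>' r1 r2 by auto
  have "build ?D ?ins n = (map f os, map (map_node f) (filter Q1 ns @ filter Q2 ns), j2)"
    using \<sigma>(4) \<sigma>'(3) h1(4) h2(4) r1(2) f1 f2 g1 g2 by simp
  moreover have "mset (filter Q1 ns @ filter Q2 ns) = mset ns"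
    unfolding Q1_def Q2_def by (simp add: mset_filter)
  then have "mset (map (map_node f) (filter Q1 ns @ filter Q2 ns)) = image_mset (map_node f) (mset ns)"
    by (metis mset_map)
  moreover have "nin ?D = n" using \<sigma> by simp
  moreover have fid: "f l = l" if "l < n" for l using that h1(1) h2(1) by (auto simp: f_def)
  then have "map f ?ins = ?ins" by (intro map_idI) auto
  ultimately have graph: "graph_of ?D = rename_graph f (graph_of D)"
    using b by (simp add: graph_of_def rename_graph_def n_def[symmetric] Let_def)
  have inj: "inj_on f (edges D)"
    unfolding edges_eq_labels[OF assms(1,3)]
  proof -
    have A: "bij_betw f {..<n} {..<n}"
      by (subst bij_betw_cong[where g = id]) (auto simp: fid)
    have B: "bij_betw f ({n..<K} \<inter> Collect P1) {n..<j1}"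
      using h1(2) by (subst bij_betw_cong[where g = h1]) (auto simp: f_def P1_def)
    have C: "bij_betw f ({n..<K} \<inter> Collect P2) {j1..<j2}"
      using h2(2) by (subst bij_betw_cong[where g = h2]) (auto simp: f_def P2_def)
    have "bij_betw f (({n..<K} \<inter> Collect P1) \<union> ({n..<K} \<inter> Collect P2)) ({n..<j1} \<union> {j1..<j2})"
      by (rule bij_betw_combine[OF B C]) auto
    then have "bij_betw f ({..<n} \<union> (({n..<K} \<inter> Collect P1) \<union> ({n..<K} \<inter> Collect P2)))
        ({..<n} \<union> ({n..<j1} \<union> {j1..<j2}))"
      using h1(3) by (intro bij_betw_combine[OF A]) auto
    moreover have "{..<n} \<union> (({n..<K} \<inter> Collect P1) \<union> ({n..<K} \<inter> Collect P2)) = {..<K}"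
      using S(1) by (auto simp: P1_def P2_def)
    ultimately show "inj_on f {..<K}" by (simp add: bij_betw_def)
  qed
  have "\<not> connected_diag D"
    unfolding connected_diag_def using \<sigma>(1) \<sigma>'(1) wf ne1 ne2 inj graph by blast
  then show False using assms(2) by contradiction
qed

section \<open>Token states\<close>

definition linear_ext :: "(token multiset \<Rightarrow> complex) \<Rightarrow> tkS \<Rightarrow> complex" where
  "linear_ext g p = (\<Sum>M\<in>Poly_Mapping.keys p. Poly_Mapping.lookup p M * g M)"

lemma linear_ext_superset:
  assumes "finite A" "Poly_Mapping.keys p \<subseteq> A"
  shows "linear_ext g p = (\<Sum>M\<in>A. Poly_Mapping.lookup p M * g M)"
  unfolding linear_ext_def using assms
  by (intro sum.mono_neutral_left) (auto simp: in_keys_iff)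

lemma linear_ext_add: "linear_ext g (p + q) = linear_ext g p + linear_ext g q"
proof -
  let ?A = "Poly_Mapping.keys p \<union> Poly_Mapping.keys q"
  have "linear_ext g (p + q) = (\<Sum>M\<in>?A. Poly_Mapping.lookup (p + q) M * g M)"
    by (rule linear_ext_superset) (auto dest: set_mp[OF keys_add])
  then show ?thesis
    by (simp add: linear_ext_superset[of ?A] lookup_add distrib_right sum.distrib)
qed

lemma linear_ext_diff: "linear_ext g (p - q) = linear_ext g p - linear_ext g q"
proof -
  have "linear_ext g (p - q + q) = linear_ext g (p - q) + linear_ext g q" by (rule linear_ext_add)
  then show ?thesis by simp
qed

lemma linear_ext_0 [simp]: "linear_ext g 0 = 0"
  by (simp add: linear_ext_def)

lemma linear_ext_single [simp]: "linear_ext g (Poly_Mapping.single M c) = c * g M"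
  by (subst linear_ext_superset[of "{M}"]) auto

lemma linear_ext_sum: "linear_ext g (sum p A) = (\<Sum>a\<in>A. linear_ext g (p a))"
  by (induction A rule: infinite_finite_induct) (auto simp: linear_ext_add)

lemma poly_mapping_eq_sum_single:
  fixes p :: tkS
  shows "p = (\<Sum>M\<in>Poly_Mapping.keys p. Poly_Mapping.single M (Poly_Mapping.lookup p M))"
proof (rule poly_mapping_eqI)
  fix M
  have "(\<Sum>M'\<in>Poly_Mapping.keys p. Poly_Mapping.lookup (Poly_Mapping.single M' (Poly_Mapping.lookup p M')) M)
    = (\<Sum>M'\<in>Poly_Mapping.keys p. if M' = M then Poly_Mapping.lookup p M' else 0)"
    by (rule sum.cong) (auto simp: lookup_single)
  also have "\<dots> = Poly_Mapping.lookup p M"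
    by (auto simp: sum.delta in_keys_iff)
  finally show "Poly_Mapping.lookup p M = Poly_Mapping.lookup (\<Sum>M\<in>Poly_Mapping.keys p. Poly_Mapping.single M (Poly_Mapping.lookup p M)) M"
    by (simp add: lookup_sum)
qed

lemma linear_ext_single_mult:
  "linear_ext g (Poly_Mapping.single A c * p) = c * linear_ext (\<lambda>M. g (A + M)) p"
proof -
  have "Poly_Mapping.single A c * p =
      (\<Sum>M\<in>Poly_Mapping.keys p. Poly_Mapping.single (A + M) (c * Poly_Mapping.lookup p M))"
    by (subst (1) poly_mapping_eq_sum_single) (simp add: sum_distrib_left mult_single)
  then have "linear_ext g (Poly_Mapping.single A c * p) =
      (\<Sum>M\<in>Poly_Mapping.keys p. c * Poly_Mapping.lookup p M * g (A + M))"
    by (simp add: linear_ext_sum)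
  then show ?thesis
    by (simp add: linear_ext_def sum_distrib_left mult.assoc)
qed

section \<open>Token monomials without their bits, and the diffusion rules seen through them\<close>

definition skel :: "token multiset \<Rightarrow> (nat \<times> dir) multiset" where
  "skel M = image_mset (\<lambda>t. (fst t, fst (snd t))) M"

lemma skel_simps [simp]:
  "skel {#} = {#}"
  "skel (add_mset t M) = add_mset (fst t, fst (snd t)) (skel M)"
  "skel (M + M') = skel M + skel M'"
  by (simp_all add: skel_def)

lemma count_skel_pos_iff: "count (skel M) (e, d) > 0 \<longleftrightarrow> (\<exists>x. (e, d, x) \<in># M)"
  by (auto simp: skel_def image_iff intro: rev_bexI)

definition agrees :: "nat set \<Rightarrow> token multiset \<Rightarrow> bool" where
  "agrees L M \<longleftrightarrow> (\<forall>t\<in>#M. (fst t \<in> L) = snd (snd t))"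

lemma agrees_simps [simp]:
  "agrees L {#}"
  "agrees L (add_mset t M) \<longleftrightarrow> (fst t \<in> L) = snd (snd t) \<and> agrees L M"
  "agrees L (M + M') \<longleftrightarrow> agrees L M \<and> agrees L M'"
  by (auto simp: agrees_def)

lemma agrees_reconstruct:
  assumes "agrees L M"
  shows "M = image_mset (\<lambda>(e, d). (e, d, e \<in> L)) (skel M)"
proof -
  have "image_mset (\<lambda>(e, d). (e, d, e \<in> L)) (skel M) = image_mset (\<lambda>t. (fst t, fst (snd t), fst t \<in> L)) M"
    by (simp add: skel_def image_mset.compositionality o_def)
  also have "\<dots> = image_mset (\<lambda>t. t) M"
    using assms by (intro image_mset_cong) (auto simp: agrees_def)
  finally show ?thesis by simp
qed

definition star :: "node \<Rightarrow> (nat \<times> dir) multiset" where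
  "star N = image_mset (\<lambda>e. (e, Up)) (mset (node_ins N)) + image_mset (\<lambda>e. (e, Down)) (mset (node_outs N))"

fun opposite :: "dir \<Rightarrow> dir" where
  "opposite Down = Up" | "opposite Up = Down"

lemma node_rule_incident:
  "node_rule N (e, d, x) p \<Longrightarrow> d = Down \<and> e \<in> set (node_ins N) \<or> d = Up \<and> e \<in> set (node_outs N)"
  by (cases N) auto

lemma node_rule_exists:
  assumes "d = Down \<and> e \<in> set (node_ins N) \<or> d = Up \<and> e \<in> set (node_outs N)"
  shows "\<exists>p. node_rule N (e, d, x) p"
  using assms by (cases N) auto

text \<open>Diffusion emits a token away from the node on every edge except the one entered. Adding
  the missing token, which would go back along \<open>e\<close>, completes the star; later arguments
  need not distinguish the generators.\<close>

lemma node_rule_skel: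
  assumes "node_rule N (e, d, x) p" "M \<in> Poly_Mapping.keys p"
  shows "add_mset (e, opposite d) (skel M) = star N"
proof (cases N)
  case (NZ es os \<alpha>)
  have rm: "add_mset (f e) (image_mset f (mset (remove1 e xs))) = image_mset f (mset xs)"
    if "e \<in> set xs" for f :: "nat \<Rightarrow> nat \<times> dir" and xs
  proof -
    have "mset xs = add_mset e (mset (remove1 e xs))" using that by simp
    then show ?thesis by (metis image_mset_add_mset)
  qed
  show ?thesis using assms NZ
    by (auto simp: star_def skel_def image_mset.compositionality o_def
        rm[of es "\<lambda>e. (e, Up)"] rm[of os "\<lambda>e. (e, Down)"]
        simp del: mset_remove1 split: if_splits)
next
  case (NH a b)
  have keys2: "M = A \<or> M = B"
    if "M \<in> Poly_Mapping.keys (Poly_Mapping.single A c + Poly_Mapping.single B c')" for A B and c c' :: complex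
    using set_mp[OF keys_add that] by (auto split: if_splits)
  show ?thesis using assms NH
    by (auto simp: star_def dest!: keys2)
qed (use assms in \<open>auto simp: star_def tok_def\<close>)

text \<open>The right-hand side of a diffusion rule is the tensor of the node with the leg
  \<open>e\<close> fixed to \<open>x\<close>, expanded into monomials. Fixing one leg of a spider
  kills one of its two summands; for the Hadamard gate the two monomials list both bits of the other
  leg.\<close>

lemma node_rule_weight:
  assumes "node_rule N (e, d, x) p" "(e \<in> L) = x"
  shows "weight L N = linear_ext (\<lambda>M. of_bool (agrees L M)) p"
proof (cases N)
  case (NZ es os \<alpha>)
  have all_remove1: "(\<forall>f\<in>set (remove1 e xs). (f \<in> L) = x) \<longleftrightarrow> (\<forall>f\<in>set xs. (f \<in> L) = x)"
    if "e \<in> set xs" for xs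
  proof -
    have "set xs = insert e (set (remove1 e xs))"
      using that by (metis mset_remove1 insert_DiffM set_mset_add_mset_insert set_mset_mset)
    then show ?thesis using assms(2) by (metis insert_iff)
  qed
  have agrees_image: "agrees L (image_mset (\<lambda>e'. (e', d, x)) (mset xs)) \<longleftrightarrow> (\<forall>f\<in>set xs. (f \<in> L) = x)" for d xs
    by (auto simp: agrees_def)
  have e: "e \<in> set (os @ es)"
    using node_rule_incident[OF assms(1)] NZ by auto
  have "linear_ext (\<lambda>M. of_bool (agrees L M)) p = phase \<alpha> x * of_bool (\<forall>f\<in>set (os @ es). (f \<in> L) = x)"
    using assms(1) unfolding NZ node_rule.simps
    by (elim disjE conjE) (simp_all add: agrees_image all_remove1 ball_Un conj_commute del: mset_remove1)
  also have "\<dots> = weight L N"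
  proof (cases x)
    case True
    then have "\<not> (\<forall>f\<in>set (os @ es). f \<notin> L)" using e assms(2) by blast
    then show ?thesis using True NZ by (simp add: phase_def)
  next
    case False
    then have "\<not> (\<forall>f\<in>set (os @ es). f \<in> L)" using e assms(2) by blast
    then show ?thesis using False NZ by (simp add: phase_def)
  qed
  finally show ?thesis by simp
next
  case (NH a b)
  then show ?thesis using assms
    by (auto simp: linear_ext_add)
qed (use assms in \<open>auto simp: tok_def\<close>)

lemma distinct_concat_nth_disjoint:
  assumes "distinct (concat xss)" "i < length xss" "j < length xss" "x \<in> set (xss ! i)" "x \<in> set (xss ! j)"
  shows "i = j"
  using assms
proof (induction xss arbitrary: i j)
  case (Cons xs xss)
  have "x \<notin> set xs" if "k < length xss" "x \<in> set (xss ! k)" for k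
    using Cons.prems(1) that nth_mem by fastforce
  then show ?case using Cons by (cases i; cases j) auto
qed simp

text \<open>Of \<open>L\<close> and \<open>insert e L\<close> exactly one passes the indicator, and
  \<open>h\<close> does not tell them apart.\<close>

lemma sum_Pow_determined:
  fixes h :: "'a set \<Rightarrow> complex"
  assumes "finite A" "e \<notin> A" "\<And>L. L \<subseteq> A \<Longrightarrow> h (insert e L) = h L"
  shows "(\<Sum>L\<in>Pow (insert e A). of_bool ((e \<in> L) = x) * h L) = (\<Sum>L\<in>Pow A. h L)"
proof -
  have "(\<Sum>L\<in>Pow (insert e A). of_bool ((e \<in> L) = x) * h L) =
    (\<Sum>L\<in>Pow A. \<Sum>L'\<in>Pow {e}. of_bool ((e \<in> L \<union> L') = x) * h (L \<union> L'))"
    using sum_Pow_Un[of A "{e}" "\<lambda>L. of_bool ((e \<in> L) = x) * h L"] assms by simp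
  also have "\<dots> = (\<Sum>L\<in>Pow A. h L)"
  proof (rule sum.cong[OF refl])
    fix L assume "L \<in> Pow A"
    then have "h (insert e L) = h L" "e \<notin> L" using assms by auto
    moreover have "Pow {e} = {{}, {e}}" by auto
    ultimately show "(\<Sum>L'\<in>Pow {e}. of_bool ((e \<in> L \<union> L') = x) * h (L \<union> L')) = h L"
      by (cases x) auto
  qed
  finally show ?thesis .
qed

text \<open>One edge of the exploration invariant across a diffusion, with the geometry reduced to
  truth values so that a finite check suffices. Here \<open>q\<close> means that the token enters
  along this edge, \<open>inn\<close> and \<open>out\<close> that the edge is an input or output of
  the node entered, \<open>a\<close> and \<open>b\<close> that its upper or lower end was traversed
  before, and \<open>z\<close> that it is the start edge.\<close>

lemma diffuse_balance:
  fixes cD cU cD' cU' :: nat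
  assumes "cD' + of_bool q = cD + of_bool out" "cU' + of_bool q = cU + of_bool inn"
    and "cD + of_bool b = cU + of_bool a" "cD \<le> 1" "cU \<le> 1"
    and "\<not> a \<Longrightarrow> \<not> b \<Longrightarrow> cD = of_bool z" "inn \<Longrightarrow> \<not> b" "out \<Longrightarrow> \<not> a"
    and "\<not> a \<Longrightarrow> \<not> b \<Longrightarrow> cD > 0 \<Longrightarrow> q" "q \<Longrightarrow> inn \<or> out" "\<not> (inn \<and> out)"
    and "z \<Longrightarrow> (out \<or> a) \<or> (inn \<or> b)"
  shows "cD' + of_bool (inn \<or> b) = cU' + of_bool (out \<or> a) \<and> cD' \<le> 1 \<and> cU' \<le> 1 \<and>
    (\<not> (out \<or> a) \<and> \<not> (inn \<or> b) \<longrightarrow> cD' = of_bool z)"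
  using assms by (cases q; cases inn; cases out; cases a; cases b; cases z) auto

lemma no_token_on_edge:
  assumes "count (skel M) (f, Down) = 0" "count (skel M) (f, Up) = 0"
  shows "f \<notin> fst ` set_mset M"
proof
  assume "f \<in> fst ` set_mset M"
  then obtain d x where "(f, d, x) \<in># M" by force
  then have "count (skel M) (f, d) > 0" using count_skel_pos_iff by blast
  then show False using assms by (cases d) auto
qed

lemma two_tokens_count:
  assumes "(f, d, True) \<in># M" "(f, d, False) \<in># M"
  shows "count (skel M) (f, d) \<ge> 2"
proof -
  obtain B where M: "M = add_mset (f, d, True) B" using assms(1) by (metis insert_DiffM)
  then have "(f, d, False) \<in># B" using assms(2) by simp
  then obtain C where "B = add_mset (f, d, False) C" by (metis insert_DiffM)
  then show ?thesis using M by simp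
qed

text \<open>Token counts on one edge once every node is traversed; \<open>inn\<close> and
  \<open>out\<close> say that it is an input or output of the diagram. The double negations are the
  literal shape that the invariant takes after its end conditions are rewritten as non-membership in
  \<open>ins\<close> and \<open>os\<close>.\<close>

lemma stuck_balance:
  fixes cD cU :: nat
  assumes "cD + of_bool (\<not> out) = cU + of_bool (\<not> inn)" "cD \<le> 1" "cU \<le> 1"
    and "\<not> \<not> inn \<Longrightarrow> \<not> \<not> out \<Longrightarrow> cD = of_bool z" "cD > 0 \<Longrightarrow> out" "cU > 0 \<Longrightarrow> inn"
    and "z \<or> \<not> inn \<or> \<not> out"
  shows "cD = of_bool out \<and> cU = of_bool inn"
  using assms by (cases inn; cases out) auto

lemma count_image_Pair:
  assumes "distinct xs"
  shows "count (image_mset (\<lambda>e. (e, d)) (mset xs)) (f, d') = of_bool (d = d' \<and> f \<in> set xs)"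
  using assms by (induction xs) auto

section \<open>Termination of collisions\<close>

lemma keys_replace:
  fixes s q :: tkS
  assumes "Poly_Mapping.lookup s M \<noteq> 0" "M' \<in> Poly_Mapping.keys (s - Poly_Mapping.single M c + q)"
  shows "M' \<in> Poly_Mapping.keys s \<or> M' \<in> Poly_Mapping.keys q"
proof -
  have "M' \<in> Poly_Mapping.keys (s - Poly_Mapping.single M c) \<or> M' \<in> Poly_Mapping.keys q"
    using set_mp[OF keys_add assms(2)] by simp
  moreover have "M \<in> Poly_Mapping.keys s" using assms(1) by (simp add: in_keys_iff)
  ultimately show ?thesis using set_mp[OF keys_diff, of M' s "Poly_Mapping.single M c"]
    by (auto split: if_splits)
qed

text \<open>A collision trades a monomial for a strictly smaller one, or for nothing, so the total
  size of the monomials decreases. This is needed because \<open>tk_step\<close> insists on a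
  collision-free result: any diffusion can thus be completed to a full step, and a terminal state
  admits none.\<close>

lemma coll_step_normalizes: "\<exists>u. coll_step\<^sup>*\<^sup>* s u \<and> collision_free u"
proof (induction s rule: measure_induct_rule[where f = "\<lambda>s. \<Sum>M\<in>Poly_Mapping.keys s. size M"])
  case (less s)
  show ?case
  proof (cases "collision_free s")
    case False
    then obtain s' where step: "coll_step s s'" by (auto simp: collision_free_def)
    then obtain M e x y where M: "Poly_Mapping.lookup s M \<noteq> 0" "(e, Down, x) \<in># M" "(e, Up, y) \<in># M"
      and s': "s' = s - Poly_Mapping.single M (Poly_Mapping.lookup s M)
               + Poly_Mapping.single (M - {#(e, Down, x), (e, Up, y)#})
                   (Poly_Mapping.lookup s M * of_bool (x = y))"
      unfolding coll_step_def by blast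
    let ?M' = "M - {#(e, Down, x), (e, Up, y)#}"
    have "{#(e, Down, x), (e, Up, y)#} \<subseteq># M"
      using M by (simp add: insert_subset_eq_iff in_diff_count)
    then have size: "size ?M' < size M"
      using size_mset_mono by (fastforce simp: size_Diff_submset)
    then have "?M' \<noteq> M" by auto
    have "Poly_Mapping.keys s' \<subseteq> insert ?M' (Poly_Mapping.keys s - {M})"
    proof
      fix N assume N: "N \<in> Poly_Mapping.keys s'"
      \<comment> \<open>The coefficient at \<open>M\<close> cancels exactly, and the added monomial
        is a different one.\<close>
      have "N \<noteq> M" using N \<open>?M' \<noteq> M\<close> by (auto simp: s' in_keys_iff lookup_add lookup_minus lookup_single when_def)
      then show "N \<in> insert ?M' (Poly_Mapping.keys s - {M})"
        using keys_replace[OF M(1) N[unfolded s']] by (auto split: if_splits)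
    qed
    then have "(\<Sum>M\<in>Poly_Mapping.keys s'. size M) \<le> (\<Sum>M\<in>insert ?M' (Poly_Mapping.keys s - {M}). size M)"
      by (intro sum_mono2) auto
    also have "\<dots> \<le> size ?M' + (\<Sum>M\<in>Poly_Mapping.keys s - {M}. size M)"
      by (simp add: sum.insert_if)
    also have "\<dots> < size M + (\<Sum>M\<in>Poly_Mapping.keys s - {M}. size M)" using size by simp
    also have "\<dots> = (\<Sum>M\<in>Poly_Mapping.keys s. size M)"
      using M(1) by (subst (2) sum.remove[of _ M]) (auto simp: in_keys_iff)
    finally obtain u where "coll_step\<^sup>*\<^sup>* s' u" "collision_free u" using less by blast
    then show ?thesis using step by (meson converse_rtranclp_into_rtranclp)
  qed blast
qed

lemma terminal_no_diff_step: "terminal D t \<Longrightarrow> \<not> diff_step D t s"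
  using coll_step_normalizes[of s] by (auto simp: terminal_def tk_step_def)

section \<open>Exploration of a connected network\<close>

text \<open>Only graph data is kept. The two multiset equations give every label below
  \<open>K\<close> exactly one lower end and exactly one upper end, and \<open>edgeful\<close> rules
  out nodes that no token could visit.\<close>

locale token_net =
  fixes ns :: "node list" and ins os :: "nat list" and K e0 :: nat
  assumes ins_eq: "mset (concat (map node_ins ns)) + mset os = mset [0..<K]"
    and outs_eq: "mset (concat (map node_outs ns)) + mset ins = mset [0..<K]"
    and no_loop: "N \<in> set ns \<Longrightarrow> set (node_ins N) \<inter> set (node_outs N) = {}"
    and e0: "e0 < K"
    and connected: "\<lbrakk>F \<subseteq> {..<K}; F \<noteq> {};
      \<And>N. N \<in> set ns \<Longrightarrow> node_edges N \<subseteq> F \<or> node_edges N \<inter> F = {}\<rbrakk> \<Longrightarrow> F = {..<K}"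
    and edgeful: "N \<in> set ns \<Longrightarrow> node_edges N \<noteq> {}"
begin

text \<open>Wires are read top to bottom: the lower end of an edge is at the node having it as
  input, its upper end at the node having it as output.\<close>

definition ends_below :: "nat set \<Rightarrow> nat \<Rightarrow> bool" where
  "ends_below R f \<longleftrightarrow> (\<exists>i\<in>R. f \<in> set (node_ins (ns ! i)))"

definition ends_above :: "nat set \<Rightarrow> nat \<Rightarrow> bool" where
  "ends_above R f \<longleftrightarrow> (\<exists>i\<in>R. f \<in> set (node_outs (ns ! i)))"

lemma distinct_ins: "distinct (concat (map node_ins ns) @ os)"
  and distinct_outs: "distinct (concat (map node_outs ns) @ ins)"
  using ins_eq outs_eq by (metis distinct_upt mset_append mset_eq_imp_distinct_iff)+

lemma set_ins: "set (concat (map node_ins ns)) \<union> set os = {..<K}"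
  and set_outs: "set (concat (map node_outs ns)) \<union> set ins = {..<K}"
  using ins_eq outs_eq
  by (metis mset_append set_append set_mset_mset set_upt lessThan_atLeast0)+

lemma ins_unique:
  assumes "i < length ns" "j < length ns" "f \<in> set (node_ins (ns ! i))" "f \<in> set (node_ins (ns ! j))"
  shows "i = j"
  using distinct_concat_nth_disjoint[of "map node_ins ns" i j f] assms distinct_ins by auto

lemma outs_unique:
  assumes "i < length ns" "j < length ns" "f \<in> set (node_outs (ns ! i))" "f \<in> set (node_outs (ns ! j))"
  shows "i = j"
  using distinct_concat_nth_disjoint[of "map node_outs ns" i j f] assms distinct_outs by auto

lemma os_not_consumed: "f \<in> set os \<Longrightarrow> i < length ns \<Longrightarrow> f \<notin> set (node_ins (ns ! i))"
  using distinct_ins nth_mem by fastforce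

lemma ins_not_produced: "f \<in> set ins \<Longrightarrow> i < length ns \<Longrightarrow> f \<notin> set (node_outs (ns ! i))"
  using distinct_outs nth_mem by fastforce

lemma consumed_or_output: "f < K \<Longrightarrow> f \<in> set os \<or> (\<exists>i<length ns. f \<in> set (node_ins (ns ! i)))"
  using set_ins by (auto simp: in_set_conv_nth) (metis UnE UN_E lessThan_iff in_set_conv_nth)

lemma produced_or_input: "f < K \<Longrightarrow> f \<in> set ins \<or> (\<exists>i<length ns. f \<in> set (node_outs (ns ! i)))"
  using set_outs by (auto simp: in_set_conv_nth) (metis UnE UN_E lessThan_iff in_set_conv_nth)

lemma node_edges_bound:
  assumes "i < length ns" "f \<in> node_edges (ns ! i)"
  shows "f < K"
proof -
  have "f \<in> set (concat (map node_ins ns)) \<or> f \<in> set (concat (map node_outs ns))"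
    using assms nth_mem[of i ns] by (auto simp: node_edges_eq)
  then have "f \<in> {..<K}" using set_ins set_outs by blast
  then show ?thesis by simp
qed

lemma boundary_bound: "f \<in> set os \<Longrightarrow> f < K" "f \<in> set ins \<Longrightarrow> f < K"
  using set_ins set_outs by auto

lemma count_star:
  assumes "i < length ns"
  shows "count (star (ns ! i)) (f, Down) = of_bool (f \<in> set (node_outs (ns ! i)))"
    and "count (star (ns ! i)) (f, Up) = of_bool (f \<in> set (node_ins (ns ! i)))"
proof -
  have d: "distinct (node_ins (ns ! i))" "distinct (node_outs (ns ! i))"
    using distinct_ins distinct_outs assms by (auto simp: distinct_concat_iff)
  show "count (star (ns ! i)) (f, Down) = of_bool (f \<in> set (node_outs (ns ! i)))"
    "count (star (ns ! i)) (f, Up) = of_bool (f \<in> set (node_ins (ns ! i)))"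
    using d by (auto simp: star_def count_image_Pair)
qed

text \<open>Connectedness passed from edges to nodes. The edges of a closed set of nodes form a
  union of components, and since every node has an edge, covering all edges means containing all
  nodes.\<close>

lemma region_total:
  assumes "S \<subseteq> {..<length ns}" "S \<noteq> {}"
    and closed: "\<And>l j f. l \<in> S \<Longrightarrow> j < length ns \<Longrightarrow> f \<in> node_edges (ns ! l) \<Longrightarrow>
      f \<in> node_edges (ns ! j) \<Longrightarrow> j \<in> S"
  shows "S = {..<length ns}"
proof -
  define F where "F = (\<Union>l\<in>S. node_edges (ns ! l))"
  obtain l where l: "l \<in> S" "l < length ns" using assms(1,2) by auto
  then have "F \<noteq> {}" using edgeful[of "ns ! l"] by (auto simp: F_def)
  moreover have "F \<subseteq> {..<K}"
  proof
    fix f assume "f \<in> F"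
    then obtain l where "l \<in> S" "f \<in> node_edges (ns ! l)" by (auto simp: F_def)
    then show "f \<in> {..<K}" using assms(1) node_edges_bound[of l f] by auto
  qed
  moreover have "node_edges N \<subseteq> F \<or> node_edges N \<inter> F = {}" if N: "N \<in> set ns" for N
  proof -
    obtain j where j: "j < length ns" "N = ns ! j" using N by (auto simp: in_set_conv_nth)
    show ?thesis
    proof (cases "j \<in> S")
      case False
      then show ?thesis using j closed by (auto simp: F_def)
    qed (use j in \<open>auto simp: F_def\<close>)
  qed
  ultimately have F: "F = {..<K}" using connected by metis
  have "j \<in> S" if j: "j < length ns" for j
  proof -
    obtain f where f: "f \<in> node_edges (ns ! j)" using edgeful[of "ns ! j"] j by auto
    then have "f \<in> F" using F node_edges_bound j by auto
    then show ?thesis using closed[OF _ j _ f] by (auto simp: F_def)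
  qed
  then show ?thesis using assms(1) by auto
qed

lemma ends_below_iff:
  assumes "R \<subseteq> {..<length ns}" "j < length ns" "f \<in> set (node_ins (ns ! j))"
  shows "ends_below R f \<longleftrightarrow> j \<in> R"
  using assms ins_unique unfolding ends_below_def by blast

lemma ends_above_iff:
  assumes "R \<subseteq> {..<length ns}" "j < length ns" "f \<in> set (node_outs (ns ! j))"
  shows "ends_above R f \<longleftrightarrow> j \<in> R"
  using assms outs_unique unfolding ends_above_def by blast

text \<open>R is the set of nodes that the tokens of M have already traversed, starting from the edge e0.
  Both tokens on the same edge may coexist: on e0 initially, and on an edge between
  traversed nodes as long as the collision is pending.\<close>

definition admissible :: "nat set \<Rightarrow> token multiset \<Rightarrow> bool" where
  "admissible R M \<longleftrightarrow> R \<subseteq> {..<length ns} \<and> (R \<noteq> {} \<longrightarrow> ends_above R e0 \<or> ends_below R e0) \<and>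
     (\<forall>t\<in>#M. fst t < K) \<and>
     (\<forall>f<K. count (skel M) (f, Down) + of_bool (ends_below R f) =
             count (skel M) (f, Up) + of_bool (ends_above R f) \<and>
        count (skel M) (f, Down) \<le> 1 \<and> count (skel M) (f, Up) \<le> 1 \<and>
        (\<not> ends_above R f \<and> \<not> ends_below R f \<longrightarrow> count (skel M) (f, Down) = of_bool (f = e0)))"

text \<open>Subtracting the two balance equations for \<open>M\<close> shows that an edge has its
  lower end in \<open>R\<close> but not in \<open>R'\<close> exactly when this holds for its upper
  end. So \<open>R - R'\<close> is closed under sharing edges; were it nonempty it would contain
  every node, leaving none for \<open>R'\<close>.\<close>

lemma admissible_unique:
  assumes "admissible R M" "admissible R' M" "R' \<noteq> {}"
  shows "R \<subseteq> R'"
proof (rule ccontr)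
  assume "\<not> R \<subseteq> R'"
  have R: "R \<subseteq> {..<length ns}" "R' \<subseteq> {..<length ns}"
    using assms by (auto simp: admissible_def)
  have bal: "of_bool (ends_below R f) + of_bool (ends_above R' f) = (of_bool (ends_below R' f) + of_bool (ends_above R f) :: nat)"
    if "f < K" for f
  proof -
    have "count (skel M) (f, Down) + of_bool (ends_below R f) = count (skel M) (f, Up) + of_bool (ends_above R f)"
      "count (skel M) (f, Down) + of_bool (ends_below R' f) = count (skel M) (f, Up) + of_bool (ends_above R' f)"
      using assms that by (auto simp: admissible_def)
    then show ?thesis by linarith
  qed
  have "R - R' = {..<length ns}"
  proof (rule region_total)
    fix l j f
    assume l: "l \<in> R - R'" and j: "j < length ns" and f: "f \<in> node_edges (ns ! l)" "f \<in> node_edges (ns ! j)"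
    have fK: "f < K" using node_edges_bound j f by blast
    have "l < length ns" using l R by auto
    then have "ends_below R f \<and> \<not> ends_below R' f \<or> ends_above R f \<and> \<not> ends_above R' f"
      using f(1) l R ends_below_iff[of _ l f] ends_above_iff[of _ l f] by (auto simp: node_edges_eq)
    moreover have "ends_below R f \<and> \<not> ends_below R' f \<longleftrightarrow> ends_above R f \<and> \<not> ends_above R' f"
      using bal[OF fK]
      by (cases "ends_below R f"; cases "ends_below R' f"; cases "ends_above R f"; cases "ends_above R' f"; simp)
    ultimately show "j \<in> R - R'"
      using f(2) R j ends_below_iff[of _ j f] ends_above_iff[of _ j f] by (auto simp: node_edges_eq)
  qed (use R \<open>\<not> R \<subseteq> R'\<close> in auto)
  then show False using R assms(3) by auto
qed

text \<open>The two directions on \<open>e\<close> are added on the left: one token was consumed,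
  the other belongs to the star of the node but is not emitted. Equations in this additive form
  avoid truncated subtraction.\<close>

lemma count_skel_diffuse:
  assumes "i < length ns" "(e, d, x) \<in># M" "node_rule (ns ! i) (e, d, x) p" "M' \<in> Poly_Mapping.keys p"
  shows "count (skel (M - {#(e, d, x)#} + M')) (f, Down) + of_bool (f = e) =
      count (skel M) (f, Down) + of_bool (f \<in> set (node_outs (ns ! i)))"
    and "count (skel (M - {#(e, d, x)#} + M')) (f, Up) + of_bool (f = e) =
      count (skel M) (f, Up) + of_bool (f \<in> set (node_ins (ns ! i)))"
proof -
  define A where "A = M - {#(e, d, x)#}"
  have M: "M = add_mset (e, d, x) A" using assms(2) by (simp add: A_def)
  have "skel (M - {#(e, d, x)#} + M') + {#(e, d), (e, opposite d)#} = skel M + star (ns ! i)"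
    unfolding node_rule_skel[OF assms(3,4), symmetric] by (simp add: M)
  then have *: "count (skel (M - {#(e, d, x)#} + M')) y + count {#(e, d), (e, opposite d)#} y =
      count (skel M) y + count (star (ns ! i)) y" for y
    by (metis count_union)
  show "count (skel (M - {#(e, d, x)#} + M')) (f, Down) + of_bool (f = e) =
      count (skel M) (f, Down) + of_bool (f \<in> set (node_outs (ns ! i)))"
    using *[of "(f, Down)"] by (cases d) (auto simp: count_star[OF assms(1)])
  show "count (skel (M - {#(e, d, x)#} + M')) (f, Up) + of_bool (f = e) =
      count (skel M) (f, Up) + of_bool (f \<in> set (node_ins (ns ! i)))"
    using *[of "(f, Up)"] by (cases d) (auto simp: count_star[OF assms(1)])
qed

lemma ends_insert:
  "ends_below (insert i R) f \<longleftrightarrow> f \<in> set (node_ins (ns ! i)) \<or> ends_below R f"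
  "ends_above (insert i R) f \<longleftrightarrow> f \<in> set (node_outs (ns ! i)) \<or> ends_above R f"
  by (auto simp: ends_below_def ends_above_def)

lemma ends_empty [simp]: "\<not> ends_below {} f" "\<not> ends_above {} f"
  by (auto simp: ends_below_def ends_above_def)

text \<open>Read edge by edge, the balance and the bounds mean: one end traversed, a single token
  pointing to the other end; both ends, no token or a pair waiting to collide; neither end, no token
  at all, except for the initial pair on \<open>e0\<close>.\<close>

lemma admissibleD:
  assumes "admissible R M"
  shows "R \<subseteq> {..<length ns}" "R \<noteq> {} \<Longrightarrow> ends_above R e0 \<or> ends_below R e0" "t \<in># M \<Longrightarrow> fst t < K"
    "f < K \<Longrightarrow> count (skel M) (f, Down) + of_bool (ends_below R f) =
             count (skel M) (f, Up) + of_bool (ends_above R f)"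
    "f < K \<Longrightarrow> count (skel M) (f, Down) \<le> 1" "f < K \<Longrightarrow> count (skel M) (f, Up) \<le> 1"
    "f < K \<Longrightarrow> \<not> ends_above R f \<Longrightarrow> \<not> ends_below R f \<Longrightarrow> count (skel M) (f, Down) = of_bool (f = e0)"
  using assms unfolding admissible_def by auto

lemma admissible_diffuse:
  assumes adm: "admissible R M" and t: "(e, d, x) \<in># M" and i: "i < length ns" "i \<notin> R"
    and rule: "node_rule (ns ! i) (e, d, x) p" and M': "M' \<in> Poly_Mapping.keys p"
  shows "admissible (insert i R) (M - {#(e, d, x)#} + M')"
proof -
  note adm' = admissibleD[OF adm]
  note cnt = count_skel_diffuse[OF i(1) t rule M']
  have fresh: "f \<in> set (node_ins (ns ! i)) \<Longrightarrow> \<not> ends_below R f"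
    "f \<in> set (node_outs (ns ! i)) \<Longrightarrow> \<not> ends_above R f" for f
    using ends_below_iff[OF adm'(1) i(1)] ends_above_iff[OF adm'(1) i(1)] i(2) by auto
  have inc: "e \<in> set (node_ins (ns ! i)) \<or> e \<in> set (node_outs (ns ! i))"
    using node_rule_incident[OF rule] by auto
  have eK: "e < K" using adm'(3)[OF t] by simp
  \<comment> \<open>An edge with a token but no traversed end is \<open>e0\<close>, so nothing has
    been traversed yet, and the diffusing token, having no other edge to be on, enters along
    \<open>e0\<close>.\<close>
  have single: "f = e" if "f < K" "\<not> ends_above R f" "\<not> ends_below R f" "count (skel M) (f, Down) > 0" for f
  proof -
    have f: "f = e0" using adm'(7)[OF that(1-3)] that(4) by (auto split: if_splits)
    then have "R = {}" using adm'(2) that by auto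
    then have "count (skel M) (e, Down) = of_bool (e = e0)" "count (skel M) (e, Down) = count (skel M) (e, Up)"
      using adm'(4,7)[OF eK] by auto
    moreover have "count (skel M) (e, d) > 0" using t count_skel_pos_iff by blast
    ultimately show ?thesis using f
      by (cases d; cases "e = e0") (auto split: if_splits simp del: count_greater_zero_iff)
  qed
  have touch: "ends_above (insert i R) e0 \<or> ends_below (insert i R) e0"
  proof (cases "R = {}")
    case True
    have "count (skel M) (e, d) > 0" using t count_skel_pos_iff by blast
    then show ?thesis using adm'(4,7)[OF eK] True inc
      by (cases d; cases "e = e0") (auto simp: ends_insert split: if_splits simp del: count_greater_zero_iff)
  qed (use adm'(2) in \<open>auto simp: ends_insert\<close>)
  have "fst t' < K" if "t' \<in># M - {#(e, d, x)#} + M'" for t'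
  proof (cases "t' \<in># M'")
    case True
    then have "(fst t', fst (snd t')) \<in># star (ns ! i)"
      unfolding node_rule_skel[OF rule M', symmetric] by (auto simp: skel_def)
    then show ?thesis using node_edges_bound[OF i(1)] by (auto simp: star_def node_edges_eq)
  next
    case False
    then have "t' \<in># M" using that by (auto dest: in_diffD)
    then show ?thesis by (rule adm'(3))
  qed
  moreover have "count (skel (M - {#(e, d, x)#} + M')) (f, Down) + of_bool (ends_below (insert i R) f) =
             count (skel (M - {#(e, d, x)#} + M')) (f, Up) + of_bool (ends_above (insert i R) f) \<and>
        count (skel (M - {#(e, d, x)#} + M')) (f, Down) \<le> 1 \<and> count (skel (M - {#(e, d, x)#} + M')) (f, Up) \<le> 1 \<and>
        (\<not> ends_above (insert i R) f \<and> \<not> ends_below (insert i R) f \<longrightarrow>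
           count (skel (M - {#(e, d, x)#} + M')) (f, Down) = of_bool (f = e0))" if f: "f < K" for f
  proof -
    have nl: "\<not> (f \<in> set (node_ins (ns ! i)) \<and> f \<in> set (node_outs (ns ! i)))"
      using no_loop[of "ns ! i"] i by auto
    show ?thesis
      unfolding ends_insert
      by (rule diffuse_balance[OF cnt[of f] adm'(4-7)[OF f] fresh[of f] single[OF f] _ nl])
        (use inc touch in \<open>auto simp: ends_insert\<close>)
  qed
  ultimately show ?thesis using touch adm'(1) i unfolding admissible_def by auto
qed

text \<open>Tokens point out of the traversed region. One that heads for a node of \<open>R\<close>
  would by the balance face an opposite token on its own edge.\<close>

lemma not_traversed:
  assumes adm: "admissible R M" and t: "(e, d, x) \<in># M" and i: "i < length ns"
    and rule: "node_rule (ns ! i) (e, d, x) p"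
    and free: "R = {} \<or> \<not> (count (skel M) (e, Down) > 0 \<and> count (skel M) (e, Up) > 0)"
  shows "i \<notin> R"
proof
  assume "i \<in> R"
  have eK: "e < K" using admissibleD(3)[OF adm t] by simp
  have "count (skel M) (e, d) > 0" using t count_skel_pos_iff by blast
  moreover have "d = Down \<and> ends_below R e \<or> d = Up \<and> ends_above R e"
    using node_rule_incident[OF rule] \<open>i \<in> R\<close> by (auto simp: ends_below_def ends_above_def)
  ultimately show False
    using admissibleD(4)[OF adm eK] free \<open>i \<in> R\<close>
    by (auto simp: of_bool_def simp del: count_greater_zero_iff split: if_splits)
qed

section \<open>Amplitudes and their invariance under diffusion and collision\<close>

definition boundary_tokens :: "nat set \<Rightarrow> token multiset" where
  "boundary_tokens L = image_mset (\<lambda>f. (f, Down, f \<in> L)) (mset os) + image_mset (\<lambda>f. (f, Up, f \<in> L)) (mset ins)"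

text \<open>The edges whose bits are summed over. A tokenless edge inside the region must be left
  out, since its free bit would double the sum; while tokens wait on it, their bits still have to be
  compared.\<close>

definition live_edges :: "nat set \<Rightarrow> token multiset \<Rightarrow> nat set" where
  "live_edges R M = {f. f < K \<and> \<not> (ends_above R f \<and> ends_below R f)} \<union> fst ` set_mset M"

definition residual :: "token multiset \<Rightarrow> nat set \<Rightarrow> nat set \<Rightarrow> complex" where
  "residual T R L = (\<Prod>i\<in>{..<length ns} - R. weight L (ns ! i)) * of_bool (boundary_tokens L = T)"

text \<open>The coefficient of T once the untraversed part of the diagram has been contracted against the
  bits carried by the tokens.\<close>

definition amplitude :: "token multiset \<Rightarrow> nat set \<Rightarrow> token multiset \<Rightarrow> complex" where
  "amplitude T R M = (\<Sum>L\<in>Pow (live_edges R M). of_bool (agrees L M) * residual T R L)"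

lemma residual_insert:
  assumes "i < length ns" "i \<notin> R"
  shows "residual T R L = weight L (ns ! i) * residual T (insert i R) L"
proof -
  have "{..<length ns} - R - {i} = {..<length ns} - insert i R" by auto
  then show ?thesis
    using prod.remove[of "{..<length ns} - R" i "\<lambda>i. weight L (ns ! i)"] assms
    by (simp add: residual_def mult.assoc)
qed

text \<open>With both ends at traversed nodes, the edge touches no remaining node, and it is no
  boundary edge, because such an edge lacks an end.\<close>

lemma residual_irrelevant:
  assumes R: "R \<subseteq> {..<length ns}" and f: "ends_above R f" "ends_below R f"
  shows "residual T R (insert f L) = residual T R L"
proof -
  have "weight (insert f L) (ns ! i) = weight L (ns ! i)" if i: "i \<in> {..<length ns} - R" for i
  proof (rule weight_cong)
    fix e assume "e \<in> node_edges (ns ! i)"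
    then have "e \<noteq> f"
      using i f ends_below_iff[OF R, of i f] ends_above_iff[OF R, of i f] by (auto simp: node_edges_eq)
    then show "e \<in> insert f L \<longleftrightarrow> e \<in> L" by simp
  qed
  moreover have "f \<notin> set os" "f \<notin> set ins"
    using f R os_not_consumed[of f] ins_not_produced[of f] by (auto simp: ends_below_def ends_above_def)
  then have "boundary_tokens (insert f L) = boundary_tokens L"
    unfolding boundary_tokens_def by (intro arg_cong2[where f = "(+)"] image_mset_cong) auto
  ultimately show ?thesis by (simp add: residual_def)
qed

lemma agrees_irrelevant:
  assumes "f \<notin> fst ` set_mset M"
  shows "agrees (insert f L) M = agrees L M"
  using assms by (force simp: agrees_def)

lemma finite_live_edges: "finite (live_edges R M)"
  by (auto simp: live_edges_def)

text \<open>All edges of the node are live before the step, as the node itself is untraversed. Those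
  other than \<open>e\<close> receive emitted tokens and stay live, so only \<open>e\<close> can
  drop out.\<close>

lemma live_edges_diffuse:
  assumes adm: "admissible R M" and t: "(e, d, x) \<in># M" and i: "i < length ns" "i \<notin> R"
    and rule: "node_rule (ns ! i) (e, d, x) p" and M': "M' \<in> Poly_Mapping.keys p"
  shows "insert e (live_edges (insert i R) (M - {#(e, d, x)#} + M')) = live_edges R M"
proof -
  define B where "B = M - {#(e, d, x)#}"
  have M: "set_mset M = insert (e, d, x) (set_mset B)" using t by (metis B_def insert_DiffM set_mset_add_mset_insert)
  note R = admissibleD(1)[OF adm]
  have "set_mset (add_mset (e, opposite d) (skel M')) = set_mset (star (ns ! i))"
    using node_rule_skel[OF rule M'] by simp
  then have "fst ` insert (e, opposite d) (set_mset (skel M')) = fst ` set_mset (star (ns ! i))" by simp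
  moreover have "fst ` set_mset (skel M') = fst ` set_mset M'" by (auto simp: skel_def image_image)
  moreover have "fst ` set_mset (star (ns ! i)) = node_edges (ns ! i)"
    by (auto simp: star_def node_edges_eq image_image image_Un)
  ultimately have E: "insert e (fst ` set_mset M') = node_edges (ns ! i)" by simp
  have live: "f < K" "\<not> (ends_above R f \<and> ends_below R f)" if "f \<in> node_edges (ns ! i)" for f
    using that node_edges_bound[OF i(1)] ends_below_iff[OF R i(1)] ends_above_iff[OF R i(1)] i(2)
    by (auto simp: node_edges_eq)
  have new: "f \<in> node_edges (ns ! i)"
    if "ends_above (insert i R) f" "ends_below (insert i R) f" "\<not> (ends_above R f \<and> ends_below R f)" for f
    using that by (auto simp: ends_insert node_edges_eq)
  have mono: "ends_above R f \<Longrightarrow> ends_above (insert i R) f" "ends_below R f \<Longrightarrow> ends_below (insert i R) f" for f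
    by (auto simp: ends_insert)
  have "insert e (live_edges (insert i R) (B + M')) =
    {f. f < K \<and> \<not> (ends_above (insert i R) f \<and> ends_below (insert i R) f)} \<union> fst ` set_mset B \<union> node_edges (ns ! i)"
    unfolding live_edges_def E[symmetric] by (auto simp: image_Un)
  also have "\<dots> = live_edges R M"
  proof -
    have "e \<in> node_edges (ns ! i)" using E by auto
    then show ?thesis
      unfolding live_edges_def M using live new mono by auto
  qed
  finally show ?thesis by (simp add: B_def)
qed

text \<open>The weight of the node is split off the residual and replaced by the expansion given by
  the rule, which is legitimate because the token fixes the bit of \<open>e\<close>. If
  \<open>e\<close> is no longer live, its determined bit is summed away; if it is, the step leaves
  the start monomial, and the token remaining on \<open>e\<close> fixes the same bit.\<close>

lemma amplitude_diffuse:
  assumes adm: "admissible R M" and t: "(e, d, x) \<in># M" and i: "i < length ns" "i \<notin> R"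
    and rule: "node_rule (ns ! i) (e, d, x) p"
    and start: "R \<noteq> {} \<and> \<not> (count (skel M) (e, Down) > 0 \<and> count (skel M) (e, Up) > 0) \<or>
      M = {#(e, Down, x), (e, Up, x)#}"
  shows "amplitude T R M = linear_ext (\<lambda>M'. amplitude T (insert i R) (M - {#(e, d, x)#} + M')) p"
proof -
  define B where "B = M - {#(e, d, x)#}"
  have M: "M = add_mset (e, d, x) B" using t by (simp add: B_def)
  let ?R = "insert i R" and ?A = "live_edges R M"
  note adm' = admissibleD[OF adm]
  have eK: "e < K" using adm'(3)[OF t] by simp
  \<comment> \<open>The new amplitude is rewritten over the old set of live edges, so that both
    sides are sums over the same labellings.\<close>
  have inner: "amplitude T ?R (B + M') =
      (\<Sum>L\<in>Pow ?A. of_bool ((e \<in> L) = x) * of_bool (agrees L B) * residual T ?R L * of_bool (agrees L M'))"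
    if M': "M' \<in> Poly_Mapping.keys p" for M'
  proof -
    have A: "insert e (live_edges ?R (B + M')) = ?A"
      using live_edges_diffuse[OF adm t i rule M'] by (simp add: B_def)
    have adm2: "admissible ?R (B + M')"
      using admissible_diffuse[OF adm t i rule M'] by (simp add: B_def)
    show ?thesis
    proof (cases "e \<in> live_edges ?R (B + M')")
      case False
      have "ends_above ?R e" "ends_below ?R e" and eB: "e \<notin> fst ` set_mset (B + M')"
        using False eK by (auto simp: live_edges_def)
      then have res: "residual T ?R (insert e L) = residual T ?R L" for L
        using residual_irrelevant[OF admissibleD(1)[OF adm2]] by blast
      have "(\<Sum>L\<in>Pow ?A. of_bool ((e \<in> L) = x) * (of_bool (agrees L (B + M')) * residual T ?R L)) =
        (\<Sum>L\<in>Pow (live_edges ?R (B + M')). of_bool (agrees L (B + M')) * residual T ?R L)"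
        unfolding A[symmetric]
        by (rule sum_Pow_determined[OF finite_live_edges False])
          (simp only: res agrees_irrelevant[OF eB])
      then show ?thesis unfolding amplitude_def
        by (simp add: of_bool_conj mult_ac)
    next
      case True
      \<comment> \<open>Otherwise the token was alone on \<open>e\<close>: the far end was already
        traversed, and after the step \<open>e\<close> lies inside the region without
        tokens.\<close>
      have "M = {#(e, Down, x), (e, Up, x)#}"
      proof (rule ccontr)
        assume "M \<noteq> {#(e, Down, x), (e, Up, x)#}"
        then have free: "\<not> (count (skel M) (e, Down) > 0 \<and> count (skel M) (e, Up) > 0)"
          using start by auto
        have pos: "count (skel M) (e, d) > 0" using t count_skel_pos_iff by blast
        have inc: "d = Down \<and> e \<in> set (node_ins (ns ! i)) \<or> d = Up \<and> e \<in> set (node_outs (ns ! i))"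
          using node_rule_incident[OF rule] .
        have nl: "\<not> (e \<in> set (node_ins (ns ! i)) \<and> e \<in> set (node_outs (ns ! i)))"
          using no_loop[of "ns ! i"] i by auto
        note cnt = count_skel_diffuse[OF i(1) t rule M', of e, folded B_def]
        have "count (skel (B + M')) (e, Down) = 0" "count (skel (B + M')) (e, Up) = 0"
          using cnt inc nl free pos adm'(5,6)[OF eK]
          by (auto simp del: count_greater_zero_iff skel_simps)
        then have "e \<notin> fst ` set_mset (B + M')"
          by (rule no_token_on_edge)
        moreover have "ends_above ?R e \<and> ends_below ?R e"
          using adm'(4)[OF eK] inc free pos ends_below_iff[OF adm'(1) i(1), of e] ends_above_iff[OF adm'(1) i(1), of e] i(2)
          unfolding ends_insert
          by (cases "ends_above R e"; cases "ends_below R e") (auto simp del: count_greater_zero_iff)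
        ultimately show False using True by (auto simp: live_edges_def)
      qed
      then have "agrees L B \<Longrightarrow> (e \<in> L) = x" for L
        unfolding B_def by (cases d) auto
      moreover have "live_edges ?R (B + M') = ?A" using A True by auto
      ultimately show ?thesis unfolding amplitude_def
        by (intro sum.cong) (auto simp: of_bool_conj)
    qed
  qed
  have "amplitude T R M = (\<Sum>L\<in>Pow ?A. of_bool ((e \<in> L) = x) * of_bool (agrees L B) * residual T ?R L *
      linear_ext (\<lambda>M'. of_bool (agrees L M')) p)"
    unfolding amplitude_def
  proof (rule sum.cong[OF refl])
    fix L
    have "agrees L M \<longleftrightarrow> (e \<in> L) = x \<and> agrees L B" by (simp add: M)
    then show "of_bool (agrees L M) * residual T R L =
      of_bool ((e \<in> L) = x) * of_bool (agrees L B) * residual T ?R L * linear_ext (\<lambda>M'. of_bool (agrees L M')) p"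
      using node_rule_weight[OF rule, of L]
      by (cases "(e \<in> L) = x") (simp_all add: residual_insert[OF i] mult_ac)
  qed
  also have "\<dots> = (\<Sum>L\<in>Pow ?A. \<Sum>M'\<in>Poly_Mapping.keys p. Poly_Mapping.lookup p M' *
      (of_bool ((e \<in> L) = x) * of_bool (agrees L B) * residual T ?R L * of_bool (agrees L M')))"
    unfolding linear_ext_def sum_distrib_left
    by (intro sum.cong refl) (simp only: mult_ac)
  also have "\<dots> = (\<Sum>M'\<in>Poly_Mapping.keys p. Poly_Mapping.lookup p M' * amplitude T ?R (B + M'))"
    by (subst sum.swap) (simp only: inner sum_distrib_left cong: sum.cong)
  finally show ?thesis unfolding linear_ext_def B_def .
qed

text \<open>Two tokens on one edge put both its ends into \<open>R\<close>, since a nonempty region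
  has touched \<open>e0\<close> and so excludes the initial pair. Then only these tokens look at the
  bit of \<open>f\<close>: distinct bits leave no compatible labelling, equal ones determine
  \<open>f\<close> and let it drop out.\<close>

lemma collide:
  assumes adm: "admissible R M" and R: "R \<noteq> {}" and D: "(f, Down, x) \<in># M" and U: "(f, Up, y) \<in># M"
  shows "admissible R (M - {#(f, Down, x), (f, Up, y)#})"
    and "amplitude T R M = of_bool (x = y) * amplitude T R (M - {#(f, Down, x), (f, Up, y)#})"
proof -
  define B where "B = M - {#(f, Down, x), (f, Up, y)#}"
  have "(f, Up, y) \<in># M - {#(f, Down, x)#}" using U by (simp add: in_diff_count)
  then have M: "M = add_mset (f, Down, x) (add_mset (f, Up, y) B)"
    using D by (metis B_def add_mset_add_single diff_diff_add_mset insert_DiffM union_commute)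
  note adm' = admissibleD[OF adm]
  have fK: "f < K" using adm'(3)[OF D] by simp
  have cB: "count (skel B) (f, Down) = 0" "count (skel B) (f, Up) = 0"
    using adm'(5,6)[OF fK] by (auto simp: M)
  have cM: "count (skel M) (f, Down) = 1" "count (skel M) (f, Up) = 1"
    using cB by (simp_all add: M)
  have "ends_above R f = ends_below R f"
    using adm'(4)[OF fK] unfolding cM by (cases "ends_above R f"; cases "ends_below R f") simp_all
  moreover have "ends_above R f \<or> ends_below R f"
    using adm'(7)[OF fK] adm'(2)[OF R] unfolding cM by (cases "f = e0") auto
  ultimately have ends: "ends_above R f" "ends_below R f" by auto
  have cnt: "g \<noteq> f \<Longrightarrow> count (skel B) (g, d) = count (skel M) (g, d)" for g d
    by (simp add: M)
  have "count (skel B) (g, Down) + of_bool (ends_below R g) = count (skel B) (g, Up) + of_bool (ends_above R g) \<and>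
      count (skel B) (g, Down) \<le> 1 \<and> count (skel B) (g, Up) \<le> 1 \<and>
      (\<not> ends_above R g \<and> \<not> ends_below R g \<longrightarrow> count (skel B) (g, Down) = of_bool (g = e0))" if "g < K" for g
    using adm'(4-7)[OF that] cnt[of g] cB ends by (cases "g = f") auto
  moreover have "\<forall>t\<in>#B. fst t < K" using adm'(3) by (auto simp: M)
  ultimately show "admissible R (M - {#(f, Down, x), (f, Up, y)#})"
    using adm'(1,2) unfolding admissible_def B_def[symmetric] by auto
  have fB: "f \<notin> fst ` set_mset B"
    using cB by (rule no_token_on_edge)
  then have fl: "f \<notin> live_edges R B" using ends by (auto simp: live_edges_def)
  have A: "live_edges R M = insert f (live_edges R B)" by (auto simp: live_edges_def M)
  have "amplitude T R M = (\<Sum>L\<in>Pow (insert f (live_edges R B)). of_bool ((f \<in> L) = x) *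
      (of_bool (x = y) * (of_bool (agrees L B) * residual T R L)))"
    unfolding amplitude_def A by (intro sum.cong refl) (auto simp: M)
  also have "\<dots> = (\<Sum>L\<in>Pow (live_edges R B). of_bool (x = y) * (of_bool (agrees L B) * residual T R L))"
    by (rule sum_Pow_determined[OF finite_live_edges fl])
      (simp only: residual_irrelevant[OF adm'(1) ends] agrees_irrelevant[OF fB])
  finally show "amplitude T R M = of_bool (x = y) * amplitude T R (M - {#(f, Down, x), (f, Up, y)#})"
    by (simp only: amplitude_def sum_distrib_left B_def)
qed

text \<open>Let \<open>F\<close> consist of \<open>e0\<close> and the edges touching
  \<open>R\<close>. An untraversed node on such an edge would have a token heading for it, so
  \<open>F\<close> is a union of components, hence everything, and \<open>R\<close> contains all
  nodes. The remaining tokens sit exactly on the boundary and determine the only labelling that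
  contributes.\<close>

lemma amplitude_stuck:
  assumes adm: "admissible R M"
    and stuck: "\<And>f d x i. (f, d, x) \<in># M \<Longrightarrow> i < length ns \<Longrightarrow>
      \<not> (d = Down \<and> f \<in> set (node_ins (ns ! i)) \<or> d = Up \<and> f \<in> set (node_outs (ns ! i)))"
    and start: "R \<noteq> {} \<or> M = {#(e0, Down, x), (e0, Up, x)#}"
  shows "amplitude T R M = of_bool (M = T)"
proof -
  note adm' = admissibleD[OF adm]
  define F where "F = {f. f < K \<and> (f = e0 \<or> ends_above R f \<or> ends_below R f)}"
  have down: "f \<in> set os" if "f < K" "count (skel M) (f, Down) > 0" for f
    using that stuck consumed_or_output[of f] count_skel_pos_iff[of M f Down] by blast
  have up: "f \<in> set ins" if "f < K" "count (skel M) (f, Up) > 0" for f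
    using that stuck produced_or_input[of f] count_skel_pos_iff[of M f Up] by blast
  have in_R: "j \<in> R" if f: "f \<in> F" and j: "j < length ns" "f \<in> node_edges (ns ! j)" for f j
  proof (rule ccontr)
    assume "j \<notin> R"
    have fK: "f < K" using f by (simp add: F_def)
    consider "f \<in> set (node_ins (ns ! j))" | "f \<in> set (node_outs (ns ! j))"
      using j by (auto simp: node_edges_eq)
    then show False
    proof cases
      case 1
      then have b: "\<not> ends_below R f" using ends_below_iff[OF adm'(1) j(1)] \<open>j \<notin> R\<close> by auto
      have "count (skel M) (f, Down) > 0"
      proof (cases "ends_above R f")
        case True
        then show ?thesis using adm'(4)[OF fK] b by (simp del: count_greater_zero_iff)
      next
        case False
        then have "f = e0" using b f by (simp add: F_def)
        then show ?thesis using adm'(7)[OF fK False b] by (simp del: count_greater_zero_iff)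
      qed
      then show False using down[OF fK] os_not_consumed[OF _ j(1)] 1 by blast
    next
      case 2
      then have a: "\<not> ends_above R f" using ends_above_iff[OF adm'(1) j(1)] \<open>j \<notin> R\<close> by auto
      have "count (skel M) (f, Up) > 0"
      proof (cases "ends_below R f")
        case True
        then show ?thesis using adm'(4)[OF fK] a by (simp del: count_greater_zero_iff)
      next
        case False
        then have "f = e0" using a f by (simp add: F_def)
        then show ?thesis using adm'(7)[OF fK a False] adm'(4)[OF fK] False a by (simp del: count_greater_zero_iff)
      qed
      then show False using up[OF fK] ins_not_produced[OF _ j(1)] 2 by blast
    qed
  qed
  have "F = {..<K}"
  proof (rule connected)
    show "F \<subseteq> {..<K}" by (auto simp: F_def)
    show "F \<noteq> {}" using e0 by (auto simp: F_def)
    fix N assume "N \<in> set ns"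
    then obtain j where j: "j < length ns" "N = ns ! j" by (auto simp: in_set_conv_nth)
    show "node_edges N \<subseteq> F \<or> node_edges N \<inter> F = {}"
    proof (cases "j \<in> R")
      case True
      then have "node_edges N \<subseteq> F"
        using j node_edges_bound[OF j(1)]
        by (auto simp: F_def node_edges_eq ends_above_def ends_below_def)
      then show ?thesis ..
    next
      case False
      then show ?thesis using in_R j by auto
    qed
  qed
  then have F: "f \<in> F" if "f < K" for f using that by simp
  have R: "R = {..<length ns}"
  proof -
    have "j \<in> R" if j: "j < length ns" for j
    proof -
      obtain f where "f \<in> node_edges (ns ! j)" using edgeful[of "ns ! j"] j by auto
      then show ?thesis using in_R F node_edges_bound j by blast
    qed
    then show ?thesis using adm'(1) by auto
  qed
  have above: "ends_above R f \<longleftrightarrow> f \<notin> set ins" if "f < K" for f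
    using produced_or_input[OF that] ins_not_produced[of f] by (auto simp: ends_above_def R)
  have below: "ends_below R f \<longleftrightarrow> f \<notin> set os" if "f < K" for f
    using consumed_or_output[OF that] os_not_consumed[of f] by (auto simp: ends_below_def R)
  have cnt: "count (skel M) (f, Down) = of_bool (f \<in> set os) \<and> count (skel M) (f, Up) = of_bool (f \<in> set ins)"
    if f: "f < K" for f
  proof -
    have "f = e0 \<or> f \<notin> set ins \<or> f \<notin> set os" using F[OF f] above[OF f] below[OF f] by (auto simp: F_def)
    then show ?thesis
      using stuck_balance[OF adm'(4-7)[OF f, unfolded above[OF f] below[OF f]] down[OF f] up[OF f]] by blast
  qed
  have skel: "skel M = image_mset (\<lambda>f. (f, Down)) (mset os) + image_mset (\<lambda>f. (f, Up)) (mset ins)"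
  proof (rule multiset_eqI)
    fix z :: "nat \<times> dir"
    obtain f d where z: "z = (f, d)" by (cases z)
    have c: "count (image_mset (\<lambda>f. (f, Down)) (mset os) + image_mset (\<lambda>f. (f, Up)) (mset ins)) (f, d) =
      of_bool (Down = d \<and> f \<in> set os) + of_bool (Up = d \<and> f \<in> set ins)"
      using distinct_ins distinct_outs by (simp add: count_image_Pair)
    show "count (skel M) z = count (image_mset (\<lambda>f. (f, Down)) (mset os) + image_mset (\<lambda>f. (f, Up)) (mset ins)) z"
    proof (cases "f < K")
      case True
      then show ?thesis unfolding z c using cnt[OF True] by (cases d) auto
    next
      case False
      then have "\<not> count (skel M) (f, d) > 0" using adm'(3) unfolding count_skel_pos_iff by fastforce
      then show ?thesis unfolding z c using False boundary_bound by (auto simp del: count_greater_zero_iff)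
    qed
  qed
  have fstM: "fst ` set_mset M = set os \<union> set ins"
  proof -
    have "fst ` set_mset M = fst ` set_mset (skel M)" by (auto simp: skel_def image_image)
    then show ?thesis unfolding skel by (auto simp: image_Un image_image)
  qed
  have live: "live_edges R M = fst ` set_mset M"
    unfolding live_edges_def using above below fstM by auto
  \<comment> \<open>The bits read off the tokens; this is a compatible labelling provided that no
    edge carries two different bits.\<close>
  define L0 where "L0 = {f. \<exists>d. (f, d, True) \<in># M}"
  have "agrees L0 M"
    unfolding agrees_def
  proof
    fix t assume t: "t \<in># M"
    obtain f d b where tf: "t = (f, d, b)" by (cases t)
    have fK: "f < K" using adm'(3)[OF t] tf by simp
    have False if "\<not> b" "(f, d', True) \<in># M" for d'
    proof (cases "d = d'")
      case True
      then have "count (skel M) (f, d) \<ge> 2" using two_tokens_count[of f d M] that t tf by auto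
      then show False using adm'(5,6)[OF fK] by (cases d) auto
    next
      \<comment> \<open>Opposite tokens on one edge occur here only on a bare wire, at once input
        and output. Nothing has been traversed then, and both tokens still have the initial
        bit.\<close>
      case False
      have "count (skel M) (f, d) > 0" "count (skel M) (f, d') > 0"
        using that t tf count_skel_pos_iff by blast+
      then have "f \<in> set os" "f \<in> set ins" using False cnt[OF fK]
        by (cases d; cases d'; auto simp del: count_greater_zero_iff split: if_splits)+
      then have nends: "\<not> ends_above R f" "\<not> ends_below R f" using above[OF fK] below[OF fK] by auto
      then have "f = e0" using F[OF fK] by (simp add: F_def)
      then have "R = {}" using nends adm'(2) by auto
      then have "M = {#(e0, Down, x), (e0, Up, x)#}" using start by simp
      then show False using that t tf by auto
    qed
    then show "(fst t \<in> L0) = snd (snd t)" using t tf by (auto simp: L0_def)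
  qed
  have "L0 \<subseteq> live_edges R M" unfolding live by (force simp: L0_def)
  have uniq: "L = L0" if "L \<subseteq> live_edges R M" "agrees L M" for L
  proof -
    have "f \<in> L \<longleftrightarrow> f \<in> L0" for f
    proof (cases "f \<in> live_edges R M")
      case True
      then obtain t where "t \<in># M" "fst t = f" unfolding live by auto
      then show ?thesis using that(2) \<open>agrees L0 M\<close> unfolding agrees_def by metis
    qed (use that(1) \<open>L0 \<subseteq> live_edges R M\<close> in auto)
    then show ?thesis by auto
  qed
  have "of_bool (agrees L M) * residual T R L = (if L = L0 then residual T R L else 0)"
    if "L \<in> Pow (live_edges R M)" for L
    using uniq[of L] that \<open>agrees L0 M\<close> by (cases "agrees L M") auto
  then have "amplitude T R M = (\<Sum>L\<in>Pow (live_edges R M). if L = L0 then residual T R L else 0)"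
    unfolding amplitude_def by (rule sum.cong[OF refl])
  also have "\<dots> = residual T R L0"
    using \<open>L0 \<subseteq> live_edges R M\<close> by (simp add: finite_live_edges)
  also have "\<dots> = of_bool (boundary_tokens L0 = T)" by (simp add: residual_def R)
  also have "boundary_tokens L0 = M"
    using agrees_reconstruct[OF \<open>agrees L0 M\<close>]
    by (simp add: skel boundary_tokens_def image_mset.compositionality o_def)
  finally show ?thesis .
qed

text \<open>The empty region is excluded because the start monomial may also be admissible with a
  full region, after a trip around a closed loop; among nonempty regions the choice is
  unique.\<close>

definition token_value :: "token multiset \<Rightarrow> token multiset \<Rightarrow> complex" where
  "token_value T M = amplitude T (THE R. R \<noteq> {} \<and> admissible R M) M"

lemma token_value_eq:
  assumes "R \<noteq> {}" "admissible R M"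
  shows "token_value T M = amplitude T R M"
proof -
  have "(THE R. R \<noteq> {} \<and> admissible R M) = R"
    using assms admissible_unique by (intro the_equality) blast+
  then show ?thesis by (simp add: token_value_def)
qed

definition explored :: "tkS \<Rightarrow> bool" where
  "explored s \<longleftrightarrow> (\<forall>M\<in>Poly_Mapping.keys s. \<exists>R. R \<noteq> {} \<and> admissible R M)"

lemma coll_step_explored:
  assumes "explored s" "coll_step s s'"
  shows "explored s' \<and> linear_ext (token_value T) s' = linear_ext (token_value T) s"
proof -
  from assms(2) obtain M e x y where M: "Poly_Mapping.lookup s M \<noteq> 0" "(e, Down, x) \<in># M" "(e, Up, y) \<in># M"
    and s': "s' = s - Poly_Mapping.single M (Poly_Mapping.lookup s M)
               + Poly_Mapping.single (M - {#(e, Down, x), (e, Up, y)#})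
                   (Poly_Mapping.lookup s M * of_bool (x = y))"
    unfolding coll_step_def by blast
  let ?M' = "M - {#(e, Down, x), (e, Up, y)#}"
  have "M \<in> Poly_Mapping.keys s" using M(1) by (simp add: in_keys_iff)
  then obtain R where R: "R \<noteq> {}" "admissible R M"
    using assms(1) unfolding explored_def by blast
  note c = collide[OF R(2,1) M(2,3)]
  have "explored s'"
    unfolding explored_def
  proof
    fix N assume "N \<in> Poly_Mapping.keys s'"
    then have "N \<in> Poly_Mapping.keys s \<or> N = ?M'"
      unfolding s' using keys_replace[OF M(1)] by (fastforce split: if_splits)
    then show "\<exists>R. R \<noteq> {} \<and> admissible R N"
      using assms(1) R(1) c(1) by (auto simp: explored_def)
  qed
  moreover have "token_value T M = of_bool (x = y) * token_value T ?M'"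
    using token_value_eq[OF R] token_value_eq[OF R(1) c(1)] c(2) by simp
  then have "linear_ext (token_value T) s' = linear_ext (token_value T) s"
    unfolding s' by (simp add: linear_ext_add linear_ext_diff)
  ultimately show ?thesis by simp
qed

lemma coll_steps_explored:
  assumes "coll_step\<^sup>*\<^sup>* s s'" "explored s"
  shows "explored s' \<and> linear_ext (token_value T) s' = linear_ext (token_value T) s"
  using assms by (induction rule: rtranclp_induct) (use coll_step_explored in auto)

lemma collision_free_counts:
  assumes "collision_free s" "Poly_Mapping.lookup s M \<noteq> 0"
  shows "\<not> (count (skel M) (e, Down) > 0 \<and> count (skel M) (e, Up) > 0)"
  using assms unfolding collision_free_def coll_step_def count_skel_pos_iff by blast

lemma diffuse_value:
  assumes adm: "admissible R M" and t: "(e, d, x) \<in># M" and i: "i < length ns"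
    and rule: "node_rule (ns ! i) (e, d, x) p"
    and start: "R \<noteq> {} \<and> \<not> (count (skel M) (e, Down) > 0 \<and> count (skel M) (e, Up) > 0) \<or>
      R = {} \<and> M = {#(e, Down, x), (e, Up, x)#}"
  shows "explored (Poly_Mapping.single (M - {#(e, d, x)#}) c * p)"
    and "linear_ext (token_value T) (Poly_Mapping.single (M - {#(e, d, x)#}) c * p) = c * amplitude T R M"
proof -
  have iR: "i \<notin> R" using not_traversed[OF adm t i rule] start by blast
  have adm2: "admissible (insert i R) (M - {#(e, d, x)#} + M')" if "M' \<in> Poly_Mapping.keys p" for M'
    using admissible_diffuse[OF adm t i iR rule that] .
  show "explored (Poly_Mapping.single (M - {#(e, d, x)#}) c * p)"
    unfolding explored_def
  proof
    fix N assume "N \<in> Poly_Mapping.keys (Poly_Mapping.single (M - {#(e, d, x)#}) c * p)"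
    then obtain M' where "M' \<in> Poly_Mapping.keys p" "N = M - {#(e, d, x)#} + M'"
      using set_mp[OF keys_mult] by (fastforce split: if_splits)
    then show "\<exists>R. R \<noteq> {} \<and> admissible R N"
      using adm2 by (intro exI[of _ "insert i R"]) simp
  qed
  have "linear_ext (token_value T) (Poly_Mapping.single (M - {#(e, d, x)#}) c * p) =
    c * linear_ext (\<lambda>M'. amplitude T (insert i R) (M - {#(e, d, x)#} + M')) p"
    unfolding linear_ext_single_mult unfolding linear_ext_def
    by (intro arg_cong[where f = "(*) c"] sum.cong refl) (simp add: token_value_eq[OF _ adm2])
  also have "\<dots> = c * amplitude T R M"
  proof -
    have "R \<noteq> {} \<and> \<not> (count (skel M) (e, Down) > 0 \<and> count (skel M) (e, Up) > 0) \<or>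
      M = {#(e, Down, x), (e, Up, x)#}" using start by blast
    then show ?thesis using amplitude_diffuse[OF adm t i iR rule, of T] by metis
  qed
  finally show "linear_ext (token_value T) (Poly_Mapping.single (M - {#(e, d, x)#}) c * p) = c * amplitude T R M" .
qed

lemma diff_step_explored:
  assumes nodes: "nodes D = mset ns" and s: "explored s" "collision_free s" and step: "diff_step D s s'"
  shows "explored s' \<and> linear_ext (token_value T) s' = linear_ext (token_value T) s"
proof -
  from step obtain M t p where M: "Poly_Mapping.lookup s M \<noteq> 0" "t \<in># M" "diff_rule D t p"
    and s': "s' = s - Poly_Mapping.single M (Poly_Mapping.lookup s M)
               + Poly_Mapping.single (M - {#t#}) (Poly_Mapping.lookup s M) * p"
    unfolding diff_step_def by blast
  obtain e d x where t: "t = (e, d, x)" by (cases t)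
  obtain i where i: "i < length ns" "node_rule (ns ! i) (e, d, x) p"
    using M(3) unfolding diff_rule_def nodes t by (auto simp: in_set_conv_nth)
  have "M \<in> Poly_Mapping.keys s" using M(1) by (simp add: in_keys_iff)
  then obtain R where R: "R \<noteq> {}" "admissible R M"
    using s(1) unfolding explored_def by blast
  note v = diffuse_value[OF R(2) M(2)[unfolded t] i
      disjI1[OF conjI[OF R(1) collision_free_counts[OF s(2) M(1)]]],
    where c = "Poly_Mapping.lookup s M"]
  have "explored s'"
    unfolding explored_def
  proof
    fix N assume "N \<in> Poly_Mapping.keys s'"
    then have "N \<in> Poly_Mapping.keys s \<or> N \<in> Poly_Mapping.keys (Poly_Mapping.single (M - {#t#}) (Poly_Mapping.lookup s M) * p)"
      unfolding s' using keys_replace[OF M(1)] by blast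
    then show "\<exists>R. R \<noteq> {} \<and> admissible R N"
      using s(1) v(1) unfolding t explored_def by blast
  qed
  moreover have "linear_ext (token_value T) s' = linear_ext (token_value T) s"
    unfolding s' t using v(2)[of T] token_value_eq[OF R, of T] by (simp add: linear_ext_add linear_ext_diff)
  ultimately show ?thesis by simp
qed

abbreviation start_tokens :: "bool \<Rightarrow> token multiset" where
  "start_tokens x \<equiv> {#(e0, Down, x), (e0, Up, x)#}"

lemma admissible_start: "admissible {} (start_tokens x)"
  using e0 unfolding admissible_def by auto

text \<open>Separate from the general step because the start state carries a colliding pair and is
  entered with the empty region. The initial monomial is consumed entirely, so the result is already
  explored.\<close>

lemma diff_step_start:
  assumes nodes: "nodes D = mset ns" and step: "diff_step D (Poly_Mapping.single (start_tokens x) 1) s'"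
  shows "explored s' \<and> linear_ext (token_value T) s' = amplitude T {} (start_tokens x)"
proof -
  from step obtain M t p where M: "Poly_Mapping.lookup (Poly_Mapping.single (start_tokens x) (1::complex)) M \<noteq> 0"
    "t \<in># M" "diff_rule D t p"
    and s': "s' = Poly_Mapping.single (start_tokens x) 1 - Poly_Mapping.single M (Poly_Mapping.lookup (Poly_Mapping.single (start_tokens x) 1) M)
               + Poly_Mapping.single (M - {#t#}) (Poly_Mapping.lookup (Poly_Mapping.single (start_tokens x) 1) M) * p"
    unfolding diff_step_def by blast
  have Ms: "M = start_tokens x" using M(1) by (auto simp: lookup_single when_def split: if_splits)
  obtain d where t: "t = (e0, d, x)" using M(2) Ms by auto
  obtain i where i: "i < length ns" "node_rule (ns ! i) (e0, d, x) p"
    using M(3) unfolding diff_rule_def nodes t by (auto simp: in_set_conv_nth)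
  have "s' = Poly_Mapping.single (M - {#t#}) 1 * p" unfolding s' Ms by simp
  then show ?thesis
    using diffuse_value[OF admissible_start M(2)[unfolded Ms t] i, where c = 1] unfolding Ms t by auto
qed

lemma tk_steps_value:
  assumes nodes: "nodes D = mset ns" and "(tk_step D)\<^sup>*\<^sup>* (Poly_Mapping.single (start_tokens x) 1) s"
  shows "s = Poly_Mapping.single (start_tokens x) 1 \<or>
    explored s \<and> collision_free s \<and> linear_ext (token_value T) s = amplitude T {} (start_tokens x)"
  using assms(2)
proof (induction rule: rtranclp_induct)
  case (step s u)
  then obtain s' where s': "diff_step D s s'" "coll_step\<^sup>*\<^sup>* s' u" "collision_free u"
    by (auto simp: tk_step_def)
  have "explored s' \<and> linear_ext (token_value T) s' = amplitude T {} (start_tokens x)"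
    using step.IH diff_step_start[OF nodes, of x s'] diff_step_explored[OF nodes _ _ s'(1)] s'(1) by auto
  then show ?case using coll_steps_explored[OF s'(2)] s'(3) by auto
qed simp

text \<open>In a terminal state every monomial is stuck, so the preserved functional weighs
  monomials by whether they equal \<open>T\<close>: it extracts that coefficient. The case without
  any step is that of a bare wire, where the initial pair remains uncollided.\<close>

lemma terminal_lookup:
  assumes nodes: "nodes D = mset ns" and "(tk_step D)\<^sup>*\<^sup>* (Poly_Mapping.single (start_tokens x) 1) s"
    and fin: "terminal D s"
  shows "Poly_Mapping.lookup s T = amplitude T {} (start_tokens x)"
proof -
  have stuck: "\<not> (d = Down \<and> f \<in> set (node_ins (ns ! i)) \<or> d = Up \<and> f \<in> set (node_outs (ns ! i)))"
    if "M \<in> Poly_Mapping.keys s" "(f, d, b) \<in># M" "i < length ns" for M f d b i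
  proof
    assume "d = Down \<and> f \<in> set (node_ins (ns ! i)) \<or> d = Up \<and> f \<in> set (node_outs (ns ! i))"
    then obtain p where "node_rule (ns ! i) (f, d, b) p" using node_rule_exists by blast
    then have "diff_rule D (f, d, b) p" using that(3) by (auto simp: diff_rule_def nodes)
    then have "\<exists>s'. diff_step D s s'"
      using that(1,2) unfolding diff_step_def in_keys_iff by blast
    then show False using terminal_no_diff_step[OF fin] by blast
  qed
  consider "s = Poly_Mapping.single (start_tokens x) 1" |
    "explored s" "linear_ext (token_value T) s = amplitude T {} (start_tokens x)"
    using tk_steps_value[OF assms(1,2), of T] by blast
  then show ?thesis
  proof cases
    case 1
    have "amplitude T {} (start_tokens x) = of_bool (start_tokens x = T)"
      by (rule amplitude_stuck[OF admissible_start]) (use stuck[of "start_tokens x"] 1 in auto)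
    then show ?thesis using 1 by (simp add: lookup_single when_def)
  next
    case 2
    have "token_value T M = of_bool (M = T)" if M: "M \<in> Poly_Mapping.keys s" for M
    proof -
      obtain R where R: "R \<noteq> {}" "admissible R M" using 2 M by (auto simp: explored_def)
      show ?thesis unfolding token_value_eq[OF R]
        by (rule amplitude_stuck[OF R(2)]) (use stuck[OF M] R(1) in auto)
    qed
    then have "linear_ext (token_value T) s = (\<Sum>M\<in>Poly_Mapping.keys s. if M = T then Poly_Mapping.lookup s M else 0)"
      unfolding linear_ext_def by (intro sum.cong) auto
    also have "\<dots> = Poly_Mapping.lookup s T" by (auto simp: in_keys_iff)
    finally show ?thesis using 2 by simp
  qed
qed

lemma amplitude_start_sum:
  "amplitude T {} (start_tokens False) + amplitude T {} (start_tokens True) =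
    (\<Sum>L\<in>Pow {..<K}. weights L ns * of_bool (boundary_tokens L = T))"
proof -
  have "live_edges {} (start_tokens x) = {..<K}" for x
    using e0 by (auto simp: live_edges_def)
  moreover have "weights L ns = (\<Prod>i<length ns. weight L (ns ! i))" for L
    by (simp add: prod.list_conv_set_nth atLeast0LessThan)
  moreover have "of_bool (agrees L (start_tokens False)) * r + of_bool (agrees L (start_tokens True)) * r = r"
    for L and r :: complex by auto
  ultimately show ?thesis
    unfolding amplitude_def residual_def by (simp only: sum.distrib[symmetric] Diff_empty)
qed

end

section \<open>Matching the state sum with the polynomial of the standard interpretation\<close>

lemma prod_tok_bits:
  "(\<Prod>i<length es. tok (es ! i, d, bits L es ! i)) = Poly_Mapping.single (image_mset (\<lambda>f. (f, d, f \<in> L)) (mset es)) 1"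
proof (induction es)
  case (Cons e es)
  have "(\<Prod>i<length (e # es). tok ((e # es) ! i, d, bits L (e # es) ! i)) =
      tok (e, d, e \<in> L) * (\<Prod>i<length es. tok (es ! i, d, bits L es ! i))"
    by (simp add: prod.lessThan_Suc_shift del: bits_simps(6) prod.lessThan_Suc)
  then show ?case by (simp only: Cons) (simp add: tok_def mult_single)
qed simp

lemma single_sum: "Poly_Mapping.single M (sum g C) = (\<Sum>a\<in>C. Poly_Mapping.single M (g a))"
  by (induction C rule: infinite_finite_induct) (auto simp: single_add)

lemma sum_bool_lists:
  fixes g :: "bool list \<Rightarrow> 'a::comm_monoid_add"
  shows "(\<Sum>xs\<in>{xs. length xs = n}. g xs) = (\<Sum>L\<in>Pow {..<n}. g (bits L [0..<n]))"
proof (rule sum.reindex_bij_witness[where i = "\<lambda>L. bits L [0..<n]" and j = "\<lambda>xs. {i. i < n \<and> xs ! i}"])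
  show "bits {i. i < n \<and> xs ! i} [0..<n] = xs" if "xs \<in> {xs. length xs = n}" for xs
    using that by (auto intro!: nth_equalityI)
  then show "g (bits {i. i < n \<and> xs ! i} [0..<n]) = g xs" if "xs \<in> {xs. length xs = n}" for xs
    using that by simp
qed auto

theorem mainTheorem12:
  fixes D :: zx and e :: nat and t :: "bool \<Rightarrow> tkS"
  assumes "wf D"
    and "connected_diag D"
    and "edges D \<noteq> {}"
    and "e \<in> edges D"
    and "\<And>x. terminal D (t x)"
    and "\<And>x. (tk_step D)\<^sup>*\<^sup>* (tok (e, Down, x) * tok (e, Up, x)) (t x)"
  shows "t False + t True =
    (\<Sum>ys\<in>{ys. length ys = nout D}. \<Sum>xs\<in>{xs. length xs = nin D}.
       Poly_Mapping.single {#} (interp D ys xs) *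
       (\<Prod>i<nout D. tok (outputs D ! i, Down, ys ! i)) *
       (\<Prod>i<nin D. tok (inputs D ! i, Up, xs ! i)))"
proof -
  define n where "n = nin D"
  define ins where "ins = [0..<n]"
  obtain os ns K where b: "build D [0..<nin D] (nin D) = (os, ns, K)"
    by (cases "build D [0..<nin D] (nin D)")
  have S: "n \<le> K" "length os = nout D"
    "\<forall>N\<in>set ns. set (node_ins N) \<inter> set (node_outs N) = {}"
    "concat (map node_outs ns) = [n..<K]"
    "mset (concat (map node_ins ns)) + mset os = mset ins + mset [n..<K]"
    using build_structure[OF assms(1) _ set_upt_subset b] by (auto simp: n_def ins_def)
  have io: "inputs D = ins" "outputs D = os" "nodes D = mset ns"
    using b by (simp_all add: inputs_def outputs_def nodes_def graph_of_def ins_def n_def)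
  have E: "edges D = {..<K}" by (rule edges_eq_labels[OF assms(1) b])
  have upt: "mset ins + mset [n..<K] = mset [0..<K]"
    unfolding ins_def mset_append[symmetric] using upt_add_eq_append[of 0 n "K - n"] S(1) by simp
  note no_cut = connected_diag_no_cut[OF assms(1,2) b]
  interpret token_net ns ins os K e
  proof
    show "mset (concat (map node_ins ns)) + mset os = mset [0..<K]" using S(5) upt by simp
    show "mset (concat (map node_outs ns)) + mset ins = mset [0..<K]"
      unfolding S(4) using upt by (simp only: add.commute)
    show "set (node_ins N) \<inter> set (node_outs N) = {}" if "N \<in> set ns" for N using S(3) that by blast
    show "e < K" using assms(4) E by simp
    show "F = {..<K}" if F: "F \<subseteq> {..<K}" "F \<noteq> {}"
      "\<And>N. N \<in> set ns \<Longrightarrow> node_edges N \<subseteq> F \<or> node_edges N \<inter> F = {}" for F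
    proof -
      have "F \<inter> {..<K} \<noteq> {}" using F(1,2) by blast
      then have "{..<K} \<subseteq> F" using no_cut[of F] F(3) by blast
      then show ?thesis using F(1) by blast
    qed
    \<comment> \<open>With the empty cut an edgeless spider would split off from the component of
      \<open>e\<close>.\<close>
    show "node_edges N \<noteq> {}" if N: "N \<in> set ns" for N
    proof
      assume "node_edges N = {}"
      then have "{..<K} \<subseteq> {}" using no_cut[of "{}"] N by blast
      then show False using assms(4) E by blast
    qed
  qed
  have start: "tok (e, Down, x) * tok (e, Up, x) = Poly_Mapping.single (start_tokens x) 1" for x
    by (simp add: tok_def mult_single add_mset_commute)
  \<comment> \<open>Input bits are fixed by \<open>L0\<close>. Every labelling of the fresh edges
    spells exactly one output string, so the sum over \<open>ys\<close> is absorbed into the one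
    over \<open>L1\<close>.\<close>
  have inner: "(\<Sum>ys\<in>{ys. length ys = nout D}. Poly_Mapping.single {#} (interp D ys (bits L0 ins)) *
       (\<Prod>i<nout D. tok (os ! i, Down, ys ! i)) * (\<Prod>i<n. tok (ins ! i, Up, bits L0 ins ! i))) =
     (\<Sum>L1\<in>Pow {n..<K}. Poly_Mapping.single (boundary_tokens (L0 \<union> L1)) (weights (L0 \<union> L1) ns))"
    if L0: "L0 \<in> Pow {..<n}" for L0
  proof -
    define A where "A ys = (\<Prod>i<nout D. tok (os ! i, Down, ys ! i))" for ys
    define B where "B = (\<Prod>i<n. tok (ins ! i, Up, bits L0 ins ! i))"
    have A: "A (bits L os) = Poly_Mapping.single (image_mset (\<lambda>f. (f, Down, f \<in> L)) (mset os)) 1" for L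
      unfolding A_def S(2)[symmetric] by (rule prod_tok_bits)
    have B: "B = Poly_Mapping.single (image_mset (\<lambda>f. (f, Up, f \<in> L0 \<union> L1)) (mset ins)) 1"
      if "L1 \<in> Pow {n..<K}" for L1
    proof -
      have "B = Poly_Mapping.single (image_mset (\<lambda>f. (f, Up, f \<in> L0)) (mset ins)) 1"
        using prod_tok_bits[of ins Up L0] by (simp add: B_def ins_def)
      also have "image_mset (\<lambda>f. (f, Up, f \<in> L0)) (mset ins) = image_mset (\<lambda>f. (f, Up, f \<in> L0 \<union> L1)) (mset ins)"
        using that by (intro image_mset_cong) (auto simp: ins_def)
      finally show ?thesis .
    qed
    have state_sum: "Poly_Mapping.single {#} (interp D ys (bits L0 ins)) =
      (\<Sum>L1\<in>Pow {n..<K}. if bits (L0 \<union> L1) os = ys then Poly_Mapping.single {#} (weights (L0 \<union> L1) ns) else 0)"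
      if "length ys = nout D" for ys
    proof -
      have "interp D ys (bits L0 ins) = (\<Sum>L1\<in>Pow {n..<K}. of_bool (bits (L0 \<union> L1) os = ys) * weights (L0 \<union> L1) ns)"
        unfolding ins_def
        by (rule interp_eq_state_sum[OF assms(1)]) (use b that L0 in \<open>auto simp: n_def\<close>)
      then show ?thesis by (simp only: single_sum) (intro sum.cong refl, auto)
    qed
    have "(\<Sum>ys\<in>{ys. length ys = nout D}. Poly_Mapping.single {#} (interp D ys (bits L0 ins)) * A ys * B) =
      (\<Sum>ys\<in>{ys. length ys = nout D}. \<Sum>L1\<in>Pow {n..<K}.
         if bits (L0 \<union> L1) os = ys then Poly_Mapping.single {#} (weights (L0 \<union> L1) ns) * A ys * B else 0)"
    proof (rule sum.cong[OF refl])
      fix ys :: "bool list" assume "ys \<in> {ys. length ys = nout D}"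
      then show "Poly_Mapping.single {#} (interp D ys (bits L0 ins)) * A ys * B = (\<Sum>L1\<in>Pow {n..<K}.
         if bits (L0 \<union> L1) os = ys then Poly_Mapping.single {#} (weights (L0 \<union> L1) ns) * A ys * B else 0)"
        by (simp only: mem_Collect_eq state_sum sum_distrib_right) (intro sum.cong refl, auto)
    qed
    also have "\<dots> = (\<Sum>L1\<in>Pow {n..<K}. \<Sum>ys\<in>{ys. length ys = nout D}.
         if bits (L0 \<union> L1) os = ys then Poly_Mapping.single {#} (weights (L0 \<union> L1) ns) * A ys * B else 0)"
      by (rule sum.swap)
    also have "\<dots> = (\<Sum>L1\<in>Pow {n..<K}. Poly_Mapping.single (boundary_tokens (L0 \<union> L1)) (weights (L0 \<union> L1) ns))"
    proof (rule sum.cong[OF refl])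
      fix L1 assume L1: "L1 \<in> Pow {n..<K}"
      have "(\<Sum>ys\<in>{ys. length ys = nout D}.
         if bits (L0 \<union> L1) os = ys then Poly_Mapping.single {#} (weights (L0 \<union> L1) ns) * A ys * B else 0) =
        Poly_Mapping.single {#} (weights (L0 \<union> L1) ns) * A (bits (L0 \<union> L1) os) * B"
        using S(2) by (subst sum.delta'[OF finite_bool_lists]) auto
      also have "\<dots> = Poly_Mapping.single (boundary_tokens (L0 \<union> L1)) (weights (L0 \<union> L1) ns)"
        unfolding A B[OF L1] boundary_tokens_def by (simp add: mult_single)
      finally show "(\<Sum>ys\<in>{ys. length ys = nout D}.
         if bits (L0 \<union> L1) os = ys then Poly_Mapping.single {#} (weights (L0 \<union> L1) ns) * A ys * B else 0) =
         Poly_Mapping.single (boundary_tokens (L0 \<union> L1)) (weights (L0 \<union> L1) ns)" .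
    qed
    finally show ?thesis unfolding A_def B_def .
  qed
  have "(\<Sum>ys\<in>{ys. length ys = nout D}. \<Sum>xs\<in>{xs. length xs = nin D}.
       Poly_Mapping.single {#} (interp D ys xs) *
       (\<Prod>i<nout D. tok (outputs D ! i, Down, ys ! i)) *
       (\<Prod>i<nin D. tok (inputs D ! i, Up, xs ! i))) =
    (\<Sum>xs\<in>{xs. length xs = n}. \<Sum>ys\<in>{ys. length ys = nout D}.
       Poly_Mapping.single {#} (interp D ys xs) *
       (\<Prod>i<nout D. tok (os ! i, Down, ys ! i)) * (\<Prod>i<n. tok (ins ! i, Up, xs ! i)))"
    unfolding io n_def by (rule sum.swap)
  also have "\<dots> = (\<Sum>L0\<in>Pow {..<n}. \<Sum>L1\<in>Pow {n..<K}.
      Poly_Mapping.single (boundary_tokens (L0 \<union> L1)) (weights (L0 \<union> L1) ns))"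
    unfolding sum_bool_lists[where n = n] ins_def[symmetric] by (rule sum.cong[OF refl inner])
  \<comment> \<open>Input labels lie below \<open>n\<close> and all others were created by
    \<open>build\<close>, so the pairs of subsets are exactly the labellings of all edges.\<close>
  also have "\<dots> = (\<Sum>L\<in>Pow ({..<n} \<union> {n..<K}). Poly_Mapping.single (boundary_tokens L) (weights L ns))"
    by (rule sum_Pow_Un[symmetric]) auto
  also have "{..<n} \<union> {n..<K} = {..<K}" using S(1) by auto
  also have "(\<Sum>L\<in>Pow {..<K}. Poly_Mapping.single (boundary_tokens L) (weights L ns)) = t False + t True"
  proof (rule poly_mapping_eqI)
    fix T
    have "Poly_Mapping.lookup (t x) T = amplitude T {} (start_tokens x)" for x
      using terminal_lookup[OF io(3) assms(6)[of x, unfolded start] assms(5)] .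
    then have "Poly_Mapping.lookup (t False + t True) T =
        (\<Sum>L\<in>Pow {..<K}. weights L ns * of_bool (boundary_tokens L = T))"
      unfolding lookup_add by (simp only: amplitude_start_sum)
    also have "\<dots> = Poly_Mapping.lookup (\<Sum>L\<in>Pow {..<K}. Poly_Mapping.single (boundary_tokens L) (weights L ns)) T"
      unfolding lookup_sum by (intro sum.cong refl) (auto simp: lookup_single when_def)
    finally show "Poly_Mapping.lookup (\<Sum>L\<in>Pow {..<K}. Poly_Mapping.single (boundary_tokens L) (weights L ns)) T =
        Poly_Mapping.lookup (t False + t True) T" by simp
  qed
  finally show ?thesis by simp
qed

end
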